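(* Let $T$ be a finite tree with at least one edge, let $v\in V(T)$, and let $d=d_T(v)$. For each integer $k\ge 0$ let $T_k$ be the tree obtained from $T$ by attaching $k$ additional pendant edges at $v$, and let $\lambda_k=\lambda_{\max}(R_{T_k})$ be the largest eigenvalue of the Ricci matrix of $T_k$. Let $Q_\infty$ and $B$ be the matrices associated with $(T,v)$ defined in the context, and let $\lambda_\infty=\lambda_{\max}(Q_\infty)$. Assume that $\lambda_\infty$ is a simple eigenvalue of $Q_\infty$, let $r,\ell$ be vectors satisfying $Q_\infty r=\lambda_\infty r$, $\ell^{\mathsf T}Q_\infty=\lambda_\infty\ell^{\mathsf T}$, $\ell^{\mathsf T}r=1$, and define $\alpha:=\ell^{\mathsf T}Br$. If $\alpha\neq 0$, then the sequence $\{\lambda_k\}$ is strictly monotonic for sufficiently large $k$. Specifically: (1) if $\alpha>0$, then for all sufficiently large $k$, $\lambda_k>\lambda_\infty$ and $\lambda_{k+1}<\lambda_k$; (2) if $\alpha<0$, then for all sufficiently large $k$, $\lambda_k<\lambda_\infty$ and $\lambda_{k+1}>\lambda_k$.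
   Context: For a finite tree $T=(V,E)$ with at least one edge, $d_x=d_T(x)$ denotes the degree of a vertex $x$. The Ricci matrix $R_T\in\mathbb{R}^{E\times E}$ is the symmetric matrix with entries $(R_T)_{e,e}=-\bigl(\frac1{d_x}+\frac1{d_y}\bigr)$ for $e=\{x,y\}$; $(R_T)_{e,e'}=\frac1{d_z}$ if $e\ne e'$ and $e\cap e'=\{z\}$; $(R_T)_{e,e'}=0$ if $e\cap e'=\varnothing$. $\lambda_{\max}$ denotes the largest eigenvalue of a matrix all of whose eigenvalues are real. A pendant edge attached at $v$ is an edge $\{v,u\}$ where $u$ is a new vertex of degree $1$. Branches at $v$: let $u_1,\dots,u_d$ be the neighbors of $v$ in $T$, let $e_j=\{v,u_j\}$ (the root edges), and let $C_j$ be the connected component of $T-v$ containing $u_j$. The $j$-th branch edge set is $E_j=\{e_j\}\cup E(C_j)$; thus $E(T)=E_1\sqcup\dots\sqcup E_d$. The branch matrix $A_j\in\mathbb{R}^{E_j\times E_j}$ is obtained from the block of $R_T$ indexed by $E_j$ by replacing $1/d_T(v)$ by $0$: its entry at $(e_j,e_j)$ is $-1/d_T(u_j)$, and all its other entries equal the corresponding entries of $R_T$ (with degrees taken in $T$). Matrices $Q_\infty$ and $B$: both are square real matrices indexed by $E(T)\sqcup\{y\}$, where $y$ is one extra index. - $(Q_\infty)_{e,e'}=(A_j)_{e,e'}$ if $e,e'\in E_j$ for the same $j$; $(Q_\infty)_{e_j,y}=1$ for $j=1,\dots,d$; all other entries of $Q_\infty$ are $0$ (in particular the row indexed by $y$ is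 zero). All eigenvalues of $Q_\infty$ are real. - $B_{e_j,e_j}=-1$ for all $j$; $B_{e_i,e_j}=1$ for $i\neq j$; $B_{e_j,y}=-d$ and $B_{y,e_j}=1$ for all $j$; $B_{y,y}=-(d+2)$; all other entries of $B$ are $0$. "Simple" means of algebraic multiplicity one. *)

theory Defs
  imports "HOL-Library.Countable_Set" "Jordan_Normal_Form.Char_Poly"
begin

section \<open>Finite simple graphs and trees\<close>

text \<open>
  A graph is given by its vertex set and its set of edges, each edge being a two-element set of
  vertices. (The predicate \<open>tree\<close> of the AFP entry Graph\_Theory forbids directed cycles, so it
  is not the notion of an undirected tree.)
\<close>

definition finite_simple_graph :: "'a set \<Rightarrow> 'a set set \<Rightarrow> bool" where
  "finite_simple_graph V E \<longleftrightarrow> finite V \<and> (\<forall>e\<in>E. e \<subseteq> V \<and> card e = 2)"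

definition connected_graph :: "'a set \<Rightarrow> 'a set set \<Rightarrow> bool" where
  "connected_graph V E \<longleftrightarrow> V \<noteq> {} \<and> (\<forall>x\<in>V. \<forall>y\<in>V. (\<lambda>a b. {a, b} \<in> E)\<^sup>*\<^sup>* x y)"

definition is_cycle :: "'a set set \<Rightarrow> 'a list \<Rightarrow> bool" where
  "is_cycle E xs \<longleftrightarrow> length xs \<ge> 3 \<and> distinct xs \<and>
     (\<forall>i<length xs. {xs ! i, xs ! (Suc i mod length xs)} \<in> E)"

definition finite_tree :: "'a set \<Rightarrow> 'a set set \<Rightarrow> bool" where
  "finite_tree V E \<longleftrightarrow>
     finite_simple_graph V E \<and> connected_graph V E \<and> (\<nexists>xs. is_cycle E xs)"

definition vdegree :: "'a set set \<Rightarrow> 'a \<Rightarrow> nat" where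
  "vdegree E x = card {e \<in> E. x \<in> e}"

definition neighbors :: "'a set set \<Rightarrow> 'a \<Rightarrow> 'a set" where
  "neighbors E v = {u. {v, u} \<in> E}"

text \<open>
  The tree \<open>T\<^sub>k\<close>: the vertices of \<open>T\<close> are tagged with \<^const>\<open>Inl\<close>, and the \<open>k\<close> new leaves are
  \<open>Inr 0, \<dots>, Inr (k - 1)\<close>. Every \<open>T\<^sub>k\<close> thus lives on the same vertex type, and
  \<open>T\<^sub>0\<close> is the tagged copy of \<open>T\<close>. The vertex set of \<open>T\<^sub>k\<close> is not
  needed, since the Ricci matrix is determined by the edge set.
\<close>

definition pendant_edges :: "'a set set \<Rightarrow> 'a \<Rightarrow> nat \<Rightarrow> ('a + nat) set set" where
  "pendant_edges E v k = (\<lambda>e. Inl ` e) ` E \<union> (\<lambda>i. {Inl v, Inr i}) ` {..<k}"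

section \<open>Matrices indexed by a finite set\<close>

text \<open>
  A matrix indexed by a finite set \<open>I\<close> is a function of two arguments, of which only the values on
  \<open>I \<times> I\<close> matter. Eigenvalues and their multiplicities are taken from the library matrix
  obtained by enumerating \<open>I\<close>; they do not depend on the enumeration.
\<close>

definition mat_on :: "'i set \<Rightarrow> ('i \<Rightarrow> 'i \<Rightarrow> real) \<Rightarrow> real mat" where
  "mat_on I M = mat (card I) (card I) (\<lambda>(i, j). M (from_nat_into I i) (from_nat_into I j))"

text \<open>Only meant for nonempty \<open>I\<close> and matrices all of whose complex eigenvalues are real.\<close>

definition lambda_max :: "'i set \<Rightarrow> ('i \<Rightarrow> 'i \<Rightarrow> real) \<Rightarrow> real" where
  "lambda_max I M = Max {c. eigenvalue (mat_on I M) c}"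

definition simple_eigenvalue :: "'i set \<Rightarrow> ('i \<Rightarrow> 'i \<Rightarrow> real) \<Rightarrow> real \<Rightarrow> bool" where
  "simple_eigenvalue I M c \<longleftrightarrow>
     eigenvalue (mat_on I M) c \<and> order c (char_poly (mat_on I M)) = 1"

section \<open>The Ricci matrix and the limiting matrices\<close>

text \<open>
  Distinct edges of a simple graph share at most one vertex, so the off-diagonal sum below
  is \<open>1 / d\<^sub>z\<close> for the common vertex \<open>z\<close>, and \<open>0\<close> for disjoint edges.
\<close>

definition ricci :: "'a set set \<Rightarrow> 'a set \<Rightarrow> 'a set \<Rightarrow> real" where
  "ricci E e e' =
     (if e = e' then - (\<Sum>x\<in>e. 1 / real (vdegree E x))
      else (\<Sum>z\<in>e \<inter> e'. 1 / real (vdegree E z)))"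

text \<open>The vertices of the connected component of \<open>T - v\<close> containing \<open>u\<close>, for \<open>u \<noteq> v\<close>:\<close>

definition component_minus :: "'a set set \<Rightarrow> 'a \<Rightarrow> 'a \<Rightarrow> 'a set" where
  "component_minus E v u = {w. (\<lambda>a b. {a, b} \<in> E \<and> a \<noteq> v \<and> b \<noteq> v)\<^sup>*\<^sup>* u w}"

text \<open>Branches at \<open>v\<close> are indexed by the neighbours \<open>u\<close> of \<open>v\<close>; the root edge is \<open>{v, u}\<close>.\<close>

definition branch_edges :: "'a set set \<Rightarrow> 'a \<Rightarrow> 'a \<Rightarrow> 'a set set" where
  "branch_edges E v u = insert {v, u} {e \<in> E. e \<subseteq> component_minus E v u}"

definition branch_matrix :: "'a set set \<Rightarrow> 'a \<Rightarrow> 'a \<Rightarrow> 'a set \<Rightarrow> 'a set \<Rightarrow> real" where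
  "branch_matrix E v u e e' =
     (if e = {v, u} \<and> e' = {v, u} then - (1 / real (vdegree E u)) else ricci E e e')"

definition root_edges :: "'a set set \<Rightarrow> 'a \<Rightarrow> 'a set set" where
  "root_edges E v = (\<lambda>u. {v, u}) ` neighbors E v"

text \<open>The index set \<open>E(T) \<squnion> {y}\<close>, with \<^const>\<open>None\<close> as the extra index \<open>y\<close>:\<close>

definition ext_index :: "'a set set \<Rightarrow> 'a set option set" where
  "ext_index E = insert None (Some ` E)"

text \<open>
  In a tree the branch edge sets partition the edges, so for edges \<open>e, e'\<close> at most one
  neighbour \<open>u\<close> contributes to the first sum: it is \<open>A\<^sub>u e e'\<close> if both edges lie in the
  branch of \<open>u\<close>, and \<open>0\<close> if they lie in different branches.
\<close>

fun Q_inf :: "'a set set \<Rightarrow> 'a \<Rightarrow> 'a set option \<Rightarrow> 'a set option \<Rightarrow> real" where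
  "Q_inf E v (Some e) (Some e') =
     (\<Sum>u | u \<in> neighbors E v \<and> e \<in> branch_edges E v u \<and> e' \<in> branch_edges E v u.
        branch_matrix E v u e e')"
| "Q_inf E v (Some e) None = (if e \<in> root_edges E v then 1 else 0)"
| "Q_inf E v None _ = 0"

fun B_mat :: "'a set set \<Rightarrow> 'a \<Rightarrow> 'a set option \<Rightarrow> 'a set option \<Rightarrow> real" where
  "B_mat E v (Some e) (Some e') =
     (if e \<in> root_edges E v \<and> e' \<in> root_edges E v then (if e = e' then - 1 else 1) else 0)"
| "B_mat E v (Some e) None = (if e \<in> root_edges E v then - real (vdegree E v) else 0)"
| "B_mat E v None (Some e) = (if e \<in> root_edges E v then 1 else 0)"
| "B_mat E v None None = - (real (vdegree E v) + 2)"

end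

theory Submission
  imports Defs "HOL-Analysis.Elementary_Topology"
begin

text \<open>
  Put \<open>t = 1 / (d + k)\<close>. On vectors that are constant on the \<open>k\<close> pendant edges, the Ricci matrix of \<open>T\<^sub>k\<close>
  acts as \<open>Q\<^sub>\<infinity> + t B\<close>; the only other eigenvalue is \<open>- 1 - 2 t\<close>, which is irrelevant because \<open>\<lambda>\<^sub>\<infinity> \<ge> 0\<close>
  (row \<open>y\<close> of \<open>Q\<^sub>\<infinity>\<close> is zero). Let \<open>f(x, t) = det (x I - Q\<^sub>\<infinity> - t B)\<close>. Simplicity of \<open>\<lambda>\<^sub>\<infinity>\<close> gives
  \<open>f\<^sub>x(\<lambda>\<^sub>\<infinity>, 0) > 0\<close>, and \<open>f\<^sub>t(\<lambda>\<^sub>\<infinity>, 0) = - \<alpha> f\<^sub>x(\<lambda>\<^sub>\<infinity>, 0)\<close>. Hence near \<open>t = 0\<close> the largest root of \<open>f(\<cdot>, t)\<close>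
  is a strictly monotone function of \<open>t\<close>, increasing if \<open>\<alpha> > 0\<close> and decreasing if \<open>\<alpha> < 0\<close>.
\<close>

section \<open>Largest roots under perturbation\<close>

text \<open>In a small box around \<open>(a, 0)\<close> the function increases in x and decreases in
  t, so each slice has one root there, and raising t pushes it to the right. To the right of the
  box, positivity of \<open>f x 0\<close> persists for small t on the compact range up to
  \<open>M\<close>, and beyond \<open>M\<close> roots are excluded by assumption.\<close>

lemma perturbed_largest_root:
  fixes f fx ft :: "real \<Rightarrow> real \<Rightarrow> real"
  assumes dx: "\<And>x t. ((\<lambda>x. f x t) has_real_derivative fx x t) (at x)"
    and dt: "\<And>x t. ((\<lambda>t. f x t) has_real_derivative ft x t) (at t)"
    and cf: "continuous_on UNIV (\<lambda>p. f (fst p) (snd p))"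
    and cfx: "continuous_on UNIV (\<lambda>p. fx (fst p) (snd p))"
    and cft: "continuous_on UNIV (\<lambda>p. ft (fst p) (snd p))"
    and root: "f a 0 = 0"
    and pos: "fx a 0 > 0"
    and neg: "ft a 0 < 0"
    and largest: "\<And>x. x > a \<Longrightarrow> f x 0 > 0"
    and bound: "\<And>x t. \<bar>t\<bar> \<le> 1 \<Longrightarrow> x > M \<Longrightarrow> f x t \<noteq> 0"
    and \<delta>: "\<delta> > 0"
  obtains \<tau> \<mu> where "\<tau> > 0" "strict_mono_on {-\<tau><..<\<tau>} \<mu>" "\<mu> 0 = a"
    "\<And>t. \<bar>t\<bar> < \<tau> \<Longrightarrow> \<bar>\<mu> t - a\<bar> < \<delta>"
    "\<And>t. \<bar>t\<bar> < \<tau> \<Longrightarrow> f (\<mu> t) t = 0"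
    "\<And>t x. \<bar>t\<bar> < \<tau> \<Longrightarrow> x > \<mu> t \<Longrightarrow> f x t \<noteq> 0"
proof -
  have tube: "\<exists>\<epsilon>>0. \<forall>x\<in>K. \<forall>t. \<bar>t\<bar> < \<epsilon> \<longrightarrow> g x t > 0"
    if K: "compact K" and c: "continuous_on UNIV (\<lambda>p. g (fst p) (snd p))"
      and p: "\<And>x. x \<in> K \<Longrightarrow> g x 0 > 0"
    for K :: "real set" and g :: "real \<Rightarrow> real \<Rightarrow> real"
  proof -
    \<comment> \<open>The coordinates are swapped so that the compact factor comes second, as in the
      tube lemma.\<close>
    let ?W = "{p. g (snd p) (fst p) > 0}"
    have "open ?W"
      by (intro open_Collect_less continuous_intros continuous_on_compose2[OF c, of _ "\<lambda>p. (snd p, fst p)", simplified])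
    moreover have "{0} \<times> K \<subseteq> ?W" using p by auto
    ultimately obtain X where X: "0 \<in> X" "open X" "X \<times> K \<subseteq> ?W"
      using Elementary_Topology.tube_lemma[OF K] by blast
    obtain \<epsilon> where "\<epsilon> > 0" "\<And>t. dist t 0 < \<epsilon> \<Longrightarrow> t \<in> X"
      using X(1,2) unfolding open_dist by blast
    then have "g x t > 0" if "x \<in> K" "\<bar>t\<bar> < \<epsilon>" for x t
      using X(3) that by (auto simp: subset_iff)
    then show ?thesis using \<open>\<epsilon> > 0\<close> by blast
  qed
  have near: "\<exists>\<eta>>0. \<forall>x t. \<bar>x - a\<bar> \<le> \<eta> \<and> \<bar>t\<bar> \<le> \<eta> \<longrightarrow> g x t > 0"
    if c: "continuous_on UNIV (\<lambda>p. g (fst p) (snd p))" and p: "g a 0 > 0"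
    for g :: "real \<Rightarrow> real \<Rightarrow> real"
  proof -
    have "open {p. g (fst p) (snd p) > 0}"
      by (intro open_Collect_less continuous_intros c)
    then obtain A B where AB: "open A" "open B" "(a, 0) \<in> A \<times> B" "A \<times> B \<subseteq> {p. g (fst p) (snd p) > 0}"
      using p by (elim open_prod_elim[where x="(a,0)"]) auto
    obtain e1 where e1: "e1 > 0" "\<And>t. dist t a < e1 \<Longrightarrow> t \<in> A"
      using AB(1,3) unfolding open_dist by blast
    obtain e2 where e2: "e2 > 0" "\<And>t. dist t 0 < e2 \<Longrightarrow> t \<in> B"
      using AB(2,3) unfolding open_dist by blast
    have "g x t > 0" if "\<bar>x - a\<bar> \<le> min e1 e2 / 2" "\<bar>t\<bar> \<le> min e1 e2 / 2" for x t
    proof -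
      have "x \<in> A" "t \<in> B" using that e1 e2 by (auto simp: dist_real_def)
      then show ?thesis using AB(4) by (auto simp: subset_iff)
    qed
    then show ?thesis using e1(1) e2(1) by (intro exI[of _ "min e1 e2 / 2"]) auto
  qed
  obtain \<eta>1 where \<eta>1: "\<eta>1 > 0" "\<And>x t. \<bar>x - a\<bar> \<le> \<eta>1 \<Longrightarrow> \<bar>t\<bar> \<le> \<eta>1 \<Longrightarrow> fx x t > 0"
    using near[OF cfx pos] by blast
  have "continuous_on UNIV (\<lambda>p. (\<lambda>x t. - ft x t) (fst p) (snd p))"
    using cft by (intro continuous_intros)
  from near[OF this] obtain \<eta>2 where \<eta>2: "\<eta>2 > 0" "\<And>x t. \<bar>x - a\<bar> \<le> \<eta>2 \<Longrightarrow> \<bar>t\<bar> \<le> \<eta>2 \<Longrightarrow> ft x t < 0"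
    using neg by auto
  \<comment> \<open>Half of \<delta> makes the final estimate on the distance of the root from
    \<open>a\<close> strict.\<close>
  define \<eta> where "\<eta> = min (min \<eta>1 \<eta>2) (\<delta> / 2)"
  have \<eta>: "\<eta> > 0" "\<eta> \<le> \<eta>1" "\<eta> \<le> \<eta>2" "\<eta> < \<delta>" using \<eta>1(1) \<eta>2(1) \<delta> by (auto simp: \<eta>_def)
  have incr: "f x t < f x' t" if "a - \<eta> \<le> x" "x < x'" "x' \<le> a + \<eta>" "\<bar>t\<bar> \<le> \<eta>" for x x' t
    using that \<eta> by (intro DERIV_pos_imp_increasing[of x x' "\<lambda>x. f x t"]) (auto intro!: exI[of _ "fx _ t"] dx \<eta>1(2))
  have decr: "f x t > f x t'" if "a - \<eta> \<le> x" "x \<le> a + \<eta>" "- \<eta> \<le> t" "t < t'" "t' \<le> \<eta>" for x t t'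
    using that \<eta> by (intro DERIV_neg_imp_decreasing[of t t' "\<lambda>t. f x t"]) (auto intro!: exI[of _ "ft x _"] dt \<eta>2(2))
  \<comment> \<open>The maximum keeps \<open>a + \<eta>\<close> in the interval even if
    \<open>M\<close> is smaller. The bound serves twice: as the positive end for the intermediate
    value theorem and to exclude roots up to \<open>M\<close>.\<close>
  obtain \<epsilon>1 where \<epsilon>1: "\<epsilon>1 > 0" "\<And>x t. a + \<eta> \<le> x \<Longrightarrow> x \<le> max M (a + \<eta>) \<Longrightarrow> \<bar>t\<bar> < \<epsilon>1 \<Longrightarrow> f x t > 0"
    using tube[of "{a + \<eta>..max M (a + \<eta>)}", OF compact_Icc cf] largest \<eta>(1) by force
  have "continuous_on UNIV (\<lambda>p. (\<lambda>x t. - f x t) (fst p) (snd p))"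
    using cf by (intro continuous_intros)
  moreover have "f (a - \<eta>) 0 < 0" using incr[of "a - \<eta>" a 0] root \<eta>(1) by simp
  ultimately obtain \<epsilon>2 where \<epsilon>2: "\<epsilon>2 > 0" "\<And>t. \<bar>t\<bar> < \<epsilon>2 \<Longrightarrow> f (a - \<eta>) t < 0"
    using tube[of "{a - \<eta>}"] by force
  \<comment> \<open>The entry 1 makes \<open>bound\<close> applicable, and \<eta> keeps t inside the
    box.\<close>
  define \<tau> where "\<tau> = min (min \<epsilon>1 \<epsilon>2) (min 1 \<eta>)"
  have \<tau>: "\<tau> > 0" "\<tau> \<le> \<epsilon>1" "\<tau> \<le> \<epsilon>2" "\<tau> \<le> 1" "\<tau> \<le> \<eta>" using \<epsilon>1(1) \<epsilon>2(1) \<eta>(1) by (auto simp: \<tau>_def)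
  have "\<exists>x. a - \<eta> < x \<and> x < a + \<eta> \<and> f x t = 0" if t: "\<bar>t\<bar> < \<tau>" for t
  proof -
    have m: "f (a - \<eta>) t < 0" using \<epsilon>2(2)[of t] t \<tau>(3) by simp
    have p: "f (a + \<eta>) t > 0" using \<epsilon>1(2)[of "a + \<eta>" t] t \<tau>(2) by simp
    have "\<exists>x. a - \<eta> \<le> x \<and> x \<le> a + \<eta> \<and> f x t = 0"
      using m p \<eta>(1) by (intro IVT) (auto intro!: DERIV_isCont dx)
    then show ?thesis using m p by (metis less_irrefl order_le_less)
  qed
  then obtain \<mu> where \<mu>: "\<And>t. \<bar>t\<bar> < \<tau> \<Longrightarrow> a - \<eta> < \<mu> t \<and> \<mu> t < a + \<eta> \<and> f (\<mu> t) t = 0"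
    by metis
  have "\<mu> 0 = a"
    using \<mu>[of 0] incr[of a "\<mu> 0" 0] incr[of "\<mu> 0" a 0] root \<eta>(1) \<tau>(1) by (cases "\<mu> 0" a rule: linorder_cases) auto
  moreover have "strict_mono_on {-\<tau><..<\<tau>} \<mu>"
  proof (rule strict_mono_onI)
    fix s t assume s: "s \<in> {-\<tau><..<\<tau>}" and t: "t \<in> {-\<tau><..<\<tau>}" and "s < t"
    have st: "\<bar>s\<bar> < \<tau>" "\<bar>t\<bar> < \<tau>" using s t by auto
    \<comment> \<open>Passing from s to t makes the value at the old root negative, so the root of
      the slice at t lies to its right.\<close>
    have "f (\<mu> s) t < 0" using decr[of "\<mu> s" s t] \<mu>[OF st(1)] st \<open>s < t\<close> \<tau>(5) by auto
    then show "\<mu> s < \<mu> t"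
      using incr[of "\<mu> t" "\<mu> s" t] \<mu>[OF st(1)] \<mu>[OF st(2)] st \<tau>(5)
      by (cases "\<mu> s" "\<mu> t" rule: linorder_cases) auto
  qed
  moreover have "f x t \<noteq> 0" if "\<bar>t\<bar> < \<tau>" "x > \<mu> t" for x t
  proof -
    consider "x \<le> a + \<eta>" | "a + \<eta> \<le> x" "x \<le> max M (a + \<eta>)" | "x > M" by linarith
    then show ?thesis
    proof cases
      case 1 then show ?thesis using incr[of "\<mu> t" x t] \<mu>[of t] that \<tau>(5) by auto
    next
      case 2 then show ?thesis using \<epsilon>1(2)[of x t] that(1) \<tau>(2) by auto
    next
      case 3 then show ?thesis using bound[of t x] that(1) \<tau>(4) by auto
    qed
  qed
  ultimately show thesis using that[of \<tau> \<mu>] \<tau>(1) \<mu> \<eta>(4) by (auto simp: abs_less_iff) (smt (verit))+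
qed

section \<open>Eigenvalues of matrices indexed by a finite set\<close>

lemma sum_from_nat_into:
  assumes "finite I"
  shows "(\<Sum>j<card I. f (from_nat_into I j)) = (\<Sum>j\<in>I. f j)"
  using sum.reindex_bij_betw[OF bij_betw_from_nat_into_finite[OF assms], of f] .

text \<open>Later arguments can thus use functions on \<open>I\<close> as eigenvectors and forget
  the enumeration of \<open>I\<close>.\<close>

lemma eigenvalue_mat_on:
  assumes I: "finite I"
  shows "eigenvalue (mat_on I M) c \<longleftrightarrow>
    (\<exists>x. (\<exists>i\<in>I. x i \<noteq> 0) \<and> (\<forall>i\<in>I. (\<Sum>j\<in>I. M i j * x j) = c * x i))"
proof -
  let ?g = "from_nat_into I" and ?n = "card I"
  have bij: "bij_betw ?g {..<?n} I" by (rule bij_betw_from_nat_into_finite[OF I])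
  have surj: "\<exists>k<?n. i = ?g k" if "i \<in> I" for i
  proof -
    have "i \<in> ?g ` {..<?n}" using bij that by (simp add: bij_betw_def)
    then show ?thesis by blast
  qed
  have row: "(mat_on I M *\<^sub>v w) $ k = (\<Sum>j<?n. M (?g k) (?g j) * w $ j)"
    if "w \<in> carrier_vec ?n" "k < ?n" for w k
    using that by (simp add: mat_on_def scalar_prod_def lessThan_atLeast0)
  have dim: "dim_row (mat_on I M) = ?n" by (simp add: mat_on_def)
  show ?thesis
  proof
    assume "eigenvalue (mat_on I M) c"
    then obtain w where w: "w \<in> carrier_vec ?n" "w \<noteq> 0\<^sub>v ?n" "mat_on I M *\<^sub>v w = c \<cdot>\<^sub>v w"
      unfolding eigenvalue_def eigenvector_def dim by blast
    define x where "x i = w $ (the_inv_into {..<?n} ?g i)" for i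
    have x: "x (?g k) = w $ k" if "k < ?n" for k
      using bij that by (simp add: x_def bij_betw_def the_inv_into_f_f)
    obtain k where k: "k < ?n" "w $ k \<noteq> 0" 
    proof (rule ccontr)
      assume "\<not> thesis"
      then have "\<And>k. k < ?n \<Longrightarrow> w $ k = 0" using that by blast
      then have "w = 0\<^sub>v ?n" using w(1) by (intro eq_vecI) auto
      then show False using w(2) by simp
    qed
    have "(\<Sum>j\<in>I. M i j * x j) = c * x i" if "i \<in> I" for i
    proof -
      obtain k where k: "k < ?n" "i = ?g k" using surj \<open>i \<in> I\<close> by blast
      have "(\<Sum>j\<in>I. M i j * x j) = (\<Sum>j<?n. M i (?g j) * x (?g j))"
        by (rule sum_from_nat_into[OF I, symmetric])
      also have "\<dots> = (mat_on I M *\<^sub>v w) $ k" using k w(1) by (simp add: row x)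
      also have "\<dots> = c * x i" using k w(1) by (simp add: w(3) x)
      finally show ?thesis .
    qed
    moreover have "?g k \<in> I" "x (?g k) \<noteq> 0" using k bij x by (auto simp: bij_betw_def)
    ultimately show "\<exists>x. (\<exists>i\<in>I. x i \<noteq> 0) \<and> (\<forall>i\<in>I. (\<Sum>j\<in>I. M i j * x j) = c * x i)"
      by blast
  next
    assume "\<exists>x. (\<exists>i\<in>I. x i \<noteq> 0) \<and> (\<forall>i\<in>I. (\<Sum>j\<in>I. M i j * x j) = c * x i)"
    then obtain x i where x: "i \<in> I" "x i \<noteq> 0" "\<And>i. i \<in> I \<Longrightarrow> (\<Sum>j\<in>I. M i j * x j) = c * x i"
      by blast
    define w where "w = vec ?n (\<lambda>k. x (?g k))"
    obtain k where k: "k < ?n" "i = ?g k" using surj[OF x(1)] by blast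
    have "w \<noteq> 0\<^sub>v ?n" using x(2) k by (auto simp: w_def vec_eq_iff)
    moreover have "mat_on I M *\<^sub>v w = c \<cdot>\<^sub>v w"
    proof (rule eq_vecI)
      fix k assume "k < dim_vec (c \<cdot>\<^sub>v w)"
      then have k: "k < ?n" by (simp add: w_def)
      have "(mat_on I M *\<^sub>v w) $ k = (\<Sum>j<?n. M (?g k) (?g j) * x (?g j))"
        using k row[of w k] by (simp add: w_def)
      also have "\<dots> = (\<Sum>j\<in>I. M (?g k) j * x j)"
        by (rule sum_from_nat_into[OF I])
      also have "\<dots> = c * x (?g k)" using k bij by (intro x(3)) (auto simp: bij_betw_def)
      finally show "(mat_on I M *\<^sub>v w) $ k = (c \<cdot>\<^sub>v w) $ k" using k by (simp add: w_def)
    qed (simp add: mat_on_def w_def)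
    moreover have "w \<in> carrier_vec ?n" by (simp add: w_def)
    ultimately show "eigenvalue (mat_on I M) c"
      unfolding eigenvalue_def eigenvector_def dim by blast
  qed
qed

text \<open>The eigenvector equation at a coordinate of largest modulus bounds
  \<open>\<bar>c\<bar>\<close> by one absolute row sum. Summing over all rows gives a cruder bound
  that is easily made uniform along a perturbation.\<close>

lemma eigenvalue_mat_on_le:
  assumes I: "finite I" and c: "eigenvalue (mat_on I M) c"
  shows "\<bar>c\<bar> \<le> (\<Sum>i\<in>I. \<Sum>j\<in>I. \<bar>M i j\<bar>)"
proof -
  obtain x i where x: "i \<in> I" "x i \<noteq> 0" "\<And>i. i \<in> I \<Longrightarrow> (\<Sum>j\<in>I. M i j * x j) = c * x i"
    using c unfolding eigenvalue_mat_on[OF I] by blast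
  define m where "m = Max ((\<lambda>i. \<bar>x i\<bar>) ` I)"
  have "m \<in> (\<lambda>i. \<bar>x i\<bar>) ` I" unfolding m_def using I x(1) by (intro Max_in) auto
  then obtain k where k: "k \<in> I" "m = \<bar>x k\<bar>" by blast
  have le: "\<bar>x j\<bar> \<le> \<bar>x k\<bar>" if "j \<in> I" for j
    using I that unfolding k(2)[symmetric] m_def by (intro Max_ge) auto
  have "\<bar>x k\<bar> > 0" using le[OF x(1)] x(2) by linarith
  have "\<bar>c\<bar> * \<bar>x k\<bar> = \<bar>\<Sum>j\<in>I. M k j * x j\<bar>" using x(3)[OF k(1)] by (simp add: abs_mult)
  also have "\<dots> \<le> (\<Sum>j\<in>I. \<bar>M k j\<bar> * \<bar>x j\<bar>)"
    by (rule order_trans[OF sum_abs]) (simp add: abs_mult)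
  also have "\<dots> \<le> (\<Sum>j\<in>I. \<bar>M k j\<bar> * \<bar>x k\<bar>)" by (intro sum_mono mult_left_mono le) auto
  also have "\<dots> = (\<Sum>j\<in>I. \<bar>M k j\<bar>) * \<bar>x k\<bar>" by (simp add: sum_distrib_right)
  finally have "\<bar>c\<bar> \<le> (\<Sum>j\<in>I. \<bar>M k j\<bar>)" using \<open>\<bar>x k\<bar> > 0\<close> by simp
  also have "\<dots> \<le> (\<Sum>i\<in>I. \<Sum>j\<in>I. \<bar>M i j\<bar>)"
    using I k(1) by (intro member_le_sum) (auto intro: sum_nonneg)
  finally show ?thesis .
qed

lemma finite_eigenvalues_mat_on: "finite {c. eigenvalue (mat_on I M) c}"
proof -
  have car: "mat_on I M \<in> carrier_mat (card I) (card I)" by (simp add: mat_on_def)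
  have "char_poly (mat_on I M) \<noteq> 0"
    using degree_monic_char_poly[OF car] by (metis coeff_0 zero_neq_one)
  then show ?thesis
    using poly_roots_finite by (simp add: eigenvalue_root_char_poly[OF car])
qed

section \<open>Characteristic polynomials at and above the largest real eigenvalue\<close>

lemma poly_char_poly:
  fixes A :: "'a::field mat"
  assumes A: "A \<in> carrier_mat n n"
  shows "poly (char_poly A) x = det (mat n n (\<lambda>(i, j). (if i = j then x else 0) - A $$ (i, j)))"
proof -
  have "poly (char_poly A) x = det (map_mat (\<lambda>p. poly p x) (char_poly_matrix A))"
    unfolding char_poly_def by (rule comm_ring_hom.hom_det[OF poly_hom.comm_ring_hom_axioms, symmetric])
  also have "map_mat (\<lambda>p. poly p x) (char_poly_matrix A) =
      mat n n (\<lambda>(i, j). (if i = j then x else 0) - A $$ (i, j))"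
    using A by (intro eq_matI) (auto simp: char_poly_matrix_def)
  finally show ?thesis .
qed

text \<open>A monic polynomial is positive far to the right; a negative value at x would force a
  root beyond x by the intermediate value theorem.\<close>

lemma char_poly_pos_above_eigenvalues:
  assumes A: "(A :: real mat) \<in> carrier_mat n n" and le: "\<And>c. eigenvalue A c \<Longrightarrow> c \<le> a" and x: "x > a"
  shows "poly (char_poly A) x > 0"
proof (rule ccontr)
  assume "\<not> poly (char_poly A) x > 0"
  moreover have root: "poly (char_poly A) y \<noteq> 0" if "y \<ge> x" for y
    using le[of y] x that by (auto simp: eigenvalue_root_char_poly[OF A])
  ultimately have neg: "poly (char_poly A) x < 0" using root[of x, OF order.refl] by linarith
  have "lead_coeff (char_poly A) > 0" using degree_monic_char_poly[OF A] by auto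
  then obtain m where m: "\<And>y. y \<ge> m \<Longrightarrow> poly (char_poly A) y > 0"
    using poly_pinfty_gt_lc by (metis less_le_trans)
  show False
    using poly_IVT_pos[of x "max m (x + 1)" "char_poly A"] neg m root by force
qed

text \<open>At a simple root the derivative is nonzero, and a negative derivative would make the
  polynomial negative just to the right of \<open>a\<close>, where it is positive.\<close>

lemma pderiv_char_poly_pos:
  assumes A: "(A :: real mat) \<in> carrier_mat n n" and le: "\<And>c. eigenvalue A c \<Longrightarrow> c \<le> a"
    and simple: "order a (char_poly A) = 1"
  shows "poly (pderiv (char_poly A)) a > 0"
proof -
  let ?p = "char_poly A"
  have nz: "?p \<noteq> 0" using degree_monic_char_poly[OF A] by (metis coeff_0 zero_neq_one)
  have root: "poly ?p a = 0" using simple by (simp add: order_root)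
  have "order a (pderiv ?p) = 0" using order_pderiv[OF nz root] simple by simp
  moreover have "pderiv ?p \<noteq> 0"
  proof
    assume "pderiv ?p = 0"
    then obtain c where "?p = [:c:]" using pderiv_eq_0_iff degree_eq_zeroE by blast
    then show False using nz root by simp
  qed
  ultimately have "poly (pderiv ?p) a \<noteq> 0" by (simp add: order_root)
  moreover have "\<not> poly (pderiv ?p) a < 0"
  proof
    assume "poly (pderiv ?p) a < 0"
    from DERIV_neg_dec_right[OF poly_DERIV this] obtain d
      where "d > 0" "\<And>h. 0 < h \<Longrightarrow> h < d \<Longrightarrow> poly ?p (a + h) < poly ?p a" by blast
    from this(1) this(2)[of "d/2"] show False
      using char_poly_pos_above_eigenvalues[OF A le, of "a + d/2"] root by simp
  qed
  ultimately show ?thesis by simp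
qed

text \<open>Applied to the row y of \<open>Q_inf\<close>, this shows that the largest eigenvalue of
  \<open>Q_inf\<close> is at least 0.\<close>

lemma eigenvalue_mat_on_zero_row:
  assumes I: "finite I" and i: "i \<in> I" and zero: "\<And>j. j \<in> I \<Longrightarrow> M i j = 0"
  shows "eigenvalue (mat_on I M) 0"
proof -
  let ?g = "from_nat_into I" and ?n = "card I"
  have bij: "?g ` {..<?n} = I"
    using bij_betw_from_nat_into_finite[OF I] by (simp add: bij_betw_def)
  then obtain k where k: "k < ?n" "?g k = i" using i by (metis imageE lessThan_iff)
  have car: "mat_on I M \<in> carrier_mat ?n ?n" by (simp add: mat_on_def)
  \<comment> \<open>The degenerate conditional is what \<open>poly_char_poly\<close> produces at x =
    0; the determinant is expanded along the zero row.\<close>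
  let ?N = "mat ?n ?n (\<lambda>(i, j). (if i = j then 0 else 0) - mat_on I M $$ (i, j))"
  have "?N $$ (k, j) = 0" if "j < ?n" for j
    using k that zero[of "?g j"] bij by (auto simp: mat_on_def)
  then have "det ?N = 0"
    using k laplace_expansion_row[of ?N ?n k] by simp
  then show ?thesis by (simp only: eigenvalue_root_char_poly[OF car] poly_char_poly[OF car])
qed

section \<open>Perturbation of a simple largest eigenvalue\<close>

text \<open>\<open>P\<close> stands for a polynomial in x whose coefficients are polynomials in t.
  Hence \<open>pderiv P\<close> is the partial derivative in x, \<open>map_poly pderiv P\<close> the
  one in t, and this is the chain rule along a curve.\<close>

lemma has_real_derivative_poly2:
  assumes x: "(x has_real_derivative x') (at s)" and t: "(t has_real_derivative t') (at s)"
  shows "((\<lambda>s. poly (poly P [:x s:]) (t s)) has_real_derivative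
    poly (poly (pderiv P) [:x s:]) (t s) * x' + poly (poly (map_poly pderiv P) [:x s:]) (t s) * t') (at s)"
proof (induction P)
  case 0
  then show ?case by simp
next
  case (pCons a P)
  have "((\<lambda>s. poly a (t s)) has_real_derivative poly (pderiv a) (t s) * t') (at s)"
    by (rule DERIV_chain2[OF poly_DERIV t])
  from DERIV_add[OF this DERIV_mult[OF x pCons.IH]]
  show ?case
    by (simp add: pderiv_pCons Polynomial.map_poly_pCons algebra_simps)
qed

lemma continuous_on_poly2:
  "continuous_on UNIV (\<lambda>p. poly (poly P [:fst p:]) (snd p) :: real)"
  by (induction P) (auto intro!: continuous_intros)

text \<open>A Leibniz term either contains the zero entry at \<open>(i, i)\<close> or has one factor
  from row i and a different one from column i, each divisible by s.\<close>

lemma det_square_dvd: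
  fixes X :: "'a::comm_ring_1 mat"
  assumes X: "X \<in> carrier_mat n n" and i: "i < n" and zero: "X $$ (i, i) = 0"
    and row: "\<And>j. j < n \<Longrightarrow> s dvd X $$ (i, j)" and col: "\<And>j. j < n \<Longrightarrow> s dvd X $$ (j, i)"
  shows "s * s dvd det X"
  unfolding det_def'[OF X]
proof (intro dvd_sum dvd_mult)
  fix p assume "p \<in> {p. p permutes {0..<n}}"
  then have p: "p permutes {0..<n}" by simp
  show "s * s dvd (\<Prod>k = 0..<n. X $$ (k, p k))"
  proof (cases "p i = i")
    case True
    then have "(\<Prod>k = 0..<n. X $$ (k, p k)) = 0"
      using i zero by (intro prod_zero bexI[of _ i]) auto
    then show ?thesis by simp
  next
    case False
    obtain k where pk: "p k = i" using permutes_surj[OF p] by (metis surjD)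
    \<comment> \<open>Since \<open>p k = i\<close> but \<open>p i \<noteq> i\<close>, the factors of
      row i and of column i are distinct and can both be split off.\<close>
    have k: "k \<in> {0..<n} - {i}"
      using pk i False permutes_in_image[OF p, of k] by auto
    have "(\<Prod>k = 0..<n. X $$ (k, p k)) =
        X $$ (i, p i) * (X $$ (k, p k) * (\<Prod>j\<in>{0..<n} - {i} - {k}. X $$ (j, p j)))"
      using i k by (simp add: prod.remove[of "{0..<n}" i] prod.remove[of "{0..<n} - {i}" k])
    moreover have "s dvd X $$ (i, p i)"
      using row i permutes_in_image[OF p, of i] by auto
    moreover have "s dvd X $$ (k, p k)"
      using col k pk by auto
    ultimately show ?thesis by (simp add: mult_dvd_mono)
  qed
qed

lemma index_mult_mat_sum:
  assumes "A \<in> carrier_mat n n" "B \<in> carrier_mat n n" "i < n" "j < n"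
  shows "(A * B) $$ (i, j) = (\<Sum>k<n. A $$ (i, k) * B $$ (k, j))"
  using assms by (simp add: scalar_prod_def lessThan_atLeast0)

text \<open>For a kernel vector, row m forces its coordinate m to vanish, and then each other row
  forces its own coordinate to vanish.\<close>

lemma det_replace_col_unit:
  fixes r :: "nat \<Rightarrow> 'a::field"
  assumes m: "m < n" and r: "r m \<noteq> 0"
  shows "det (mat n n (\<lambda>(i, j). if j = m then r i else if i = j then 1 else 0)) \<noteq> 0" (is "det ?P \<noteq> 0")
proof
  assume "det ?P = 0"
  then obtain x where x: "x \<in> carrier_vec n" "x \<noteq> 0\<^sub>v n" "?P *\<^sub>v x = 0\<^sub>v n"
    using det_0_iff_vec_prod_zero[of ?P n] by auto
  have entry: "r i * x $ m + (if i = m then 0 else x $ i) = 0" if i: "i < n" for i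
  proof -
    have "0 = (?P *\<^sub>v x) $ i" using x i by simp
    also have "\<dots> = (\<Sum>j<n. (if j = m then r i else if i = j then 1 else 0) * x $ j)"
      using x(1) i by (simp add: scalar_prod_def lessThan_atLeast0)
    also have "\<dots> = r i * x $ m + (\<Sum>j\<in>{..<n} - {m}. (if i = j then 1 else 0) * x $ j)"
      using m by (subst sum.remove[of _ m]) (auto intro!: sum.cong)
    also have "(\<Sum>j\<in>{..<n} - {m}. (if i = j then 1 else 0) * x $ j) = (\<Sum>j\<in>{..<n} - {m}. if i = j then x $ j else 0)"
      by (intro sum.cong) auto
    also have "\<dots> = (if i = m then 0 else x $ i)"
      using i by (simp add: sum.delta)
    finally show ?thesis by simp
  qed
  have "x $ m = 0" using entry[OF m] r by simp
  then have "x $ i = 0" if "i < n" for i using entry[OF that] by (auto split: if_splits)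
  then have "x = 0\<^sub>v n" using x(1) by auto
  then show False using x(2) by simp
qed

text \<open>
  With \<open>l\<^sub>m r\<^sub>m \<noteq> 0\<close>, multiply \<open>M + s N\<close> from the left by a unit matrix with row \<open>m\<close> replaced by \<open>l\<close>, and
  from the right by one with column \<open>m\<close> replaced by \<open>r\<close>. In the product, row and column \<open>m\<close> are divisible
  by \<open>s\<close> and their common entry is \<open>s l\<^sup>TNr = 0\<close>, so every term of the Leibniz formula contains \<open>s\<close> twice.
\<close>
lemma det_pencil_square_dvd:
  fixes M N :: "nat \<Rightarrow> nat \<Rightarrow> real"
  assumes right: "\<And>i. i < n \<Longrightarrow> (\<Sum>j<n. M i j * r j) = 0"
    and left: "\<And>j. j < n \<Longrightarrow> (\<Sum>i<n. l i * M i j) = 0"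
    and cross: "(\<Sum>i<n. \<Sum>j<n. l i * N i j * r j) = 0"
    and lr: "(\<Sum>i<n. l i * r i) \<noteq> 0"
  shows "[:0, 1:] * [:0, 1:] dvd det (mat n n (\<lambda>(i, j). [:M i j, N i j:]))"
proof -
  obtain m where m: "m < n" "l m \<noteq> 0" "r m \<noteq> 0"
    using lr by (metis (no_types, lifting) lessThan_iff mult_eq_0_iff sum.neutral)
  define R where "R = mat n n (\<lambda>(i, j). if j = m then [:r i:] else if i = j then 1 else 0)"
  \<comment> \<open>The transpose puts l into row m, so that \<open>L\<close> and \<open>R\<close>
    are nonsingular by one and the same argument.\<close>
  define L where "L = (mat n n (\<lambda>(i, j). if j = m then [:l i:] else if i = j then 1 else 0))\<^sup>T"
  define Y where "Y = mat n n (\<lambda>(i, j). [:M i j, N i j:])"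
  have car: "R \<in> carrier_mat n n" "L \<in> carrier_mat n n" "Y \<in> carrier_mat n n"
    by (auto simp: R_def L_def Y_def)
  interpret const: comm_ring_hom "\<lambda>c::real. [:c:]" by unfold_locales auto
  \<comment> \<open>The transformation matrices have real entries, so their determinants over
    polynomials are nonzero constants.\<close>
  have lift: "\<exists>c. c \<noteq> 0 \<and> det (mat n n (\<lambda>(i, j). if j = m then [:x i:] else if i = j then 1 else 0)) = [:c:]"
    if "x m \<noteq> 0" for x :: "nat \<Rightarrow> real"
  proof -
    have "mat n n (\<lambda>(i, j). if j = m then [:x i:] else if i = j then 1 else 0) =
        map_mat (\<lambda>c. [:c:]) (mat n n (\<lambda>(i, j). if j = m then x i else if i = j then 1 else 0))"
      by (rule eq_matI) auto
    then show ?thesis using det_replace_col_unit[of m n x, OF m(1) that] const.hom_det by metis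
  qed
  obtain cR where cR: "cR \<noteq> 0" "det R = [:cR:]" using lift[of r] m unfolding R_def by blast
  have "det L = det (mat n n (\<lambda>(i, j). if j = m then [:l i:] else if i = j then 1 else 0))"
    unfolding L_def by (rule det_transpose) auto
  then obtain cL where cL: "cL \<noteq> 0" "det L = [:cL:]" using lift[of l] m by metis
  have LY: "(L * Y) $$ (m, j) = [:0, \<Sum>i<n. l i * N i j:]" if j: "j < n" for j
  proof -
    have "(L * Y) $$ (m, j) = (\<Sum>i<n. [:l i:] * [:M i j, N i j:])"
      using m j car by (simp add: L_def Y_def scalar_prod_def lessThan_atLeast0)
    also have "\<dots> = [:\<Sum>i<n. l i * M i j, \<Sum>i<n. l i * N i j:]"
      by (induction n) auto
    finally show ?thesis using left[OF j] by simp
  qed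
  have YR: "(Y * R) $$ (i, m) = [:0, \<Sum>j<n. N i j * r j:]" if i: "i < n" for i
  proof -
    have "(Y * R) $$ (i, m) = (\<Sum>j<n. [:M i j, N i j:] * [:r j:])"
      using m i car by (simp add: R_def Y_def scalar_prod_def lessThan_atLeast0)
    also have "\<dots> = [:\<Sum>j<n. M i j * r j, \<Sum>j<n. N i j * r j:]"
      by (induction n) (auto simp: algebra_simps)
    finally show ?thesis using right[OF i] by simp
  qed
  have s: "[:0, 1:] dvd pCons 0 q" for q :: "real poly"
    by (intro dvdI[of _ _ q]) simp
  define X where "X = L * Y * R"
  \<comment> \<open>Two bracketings are used: row m of the product is read off from
    \<open>L * Y\<close>, column m from \<open>Y * R\<close>.\<close>
  have X': "X = L * (Y * R)" unfolding X_def using car by (simp add: assoc_mult_mat)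
  have "[:0, 1:] * [:0, 1:] dvd det X"
  proof (rule det_square_dvd[of _ n m])
    show "X \<in> carrier_mat n n" "m < n" using car m by (auto simp: X_def)
    show "[:0, 1:] dvd X $$ (m, j)" if j: "j < n" for j
    proof -
      have "X $$ (m, j) = (\<Sum>k<n. (L * Y) $$ (m, k) * R $$ (k, j))"
        using m j car unfolding X_def by (intro index_mult_mat_sum) auto
      then show ?thesis using LY s by (auto intro!: dvd_sum dvd_mult2)
    qed
    show "[:0, 1:] dvd X $$ (i, m)" if i: "i < n" for i
    proof -
      have "X $$ (i, m) = (\<Sum>k<n. L $$ (i, k) * (Y * R) $$ (k, m))"
        using m i car unfolding X' by (intro index_mult_mat_sum) auto
      then show ?thesis using YR s by (auto intro!: dvd_sum dvd_mult)
    qed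
    have "X $$ (m, m) = (\<Sum>k<n. L $$ (m, k) * (Y * R) $$ (k, m))"
      using m car unfolding X' by (intro index_mult_mat_sum) auto
    also have "\<dots> = (\<Sum>k<n. [:l k:] * [:0, \<Sum>j<n. N k j * r j:])"
      using m by (intro sum.cong) (auto simp: YR L_def simp del: index_mult_mat(1))
    also have "\<dots> = [:0, \<Sum>k<n. l k * (\<Sum>j<n. N k j * r j):]"
    proof -
      have "(\<Sum>k<q. [:0, h k:]) = [:0, \<Sum>k<q. h k:]" for q and h :: "nat \<Rightarrow> real"
        by (induction q) auto
      then show ?thesis by (simp add: mult.commute)
    qed
    also have "\<dots> = 0" using cross by (simp add: sum_distrib_left mult.assoc)
    finally show "X $$ (m, m) = 0" .
  qed
  \<comment> \<open>The two outer determinants are nonzero constants, so divisibility passes from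
    \<open>det X\<close> to \<open>det Y\<close>.\<close>
  also have "det X = Polynomial.smult (cL * cR) (det Y)"
    using car cL cR by (simp add: X_def det_mult[of _ n] mult.commute)
  finally show ?thesis
    using cL cR by (simp add: Y_def dvd_smult_iff)
qed

text \<open>The root lemma is applied to \<open>det (x I - A - t H)\<close>. A negative value of the
  bilinear form reduces to this case by replacing \<open>H\<close> with \<open>- H\<close>, which
  reverses t.\<close>

lemma largest_eigenvalue_perturbation:
  fixes A H :: "'i \<Rightarrow> 'i \<Rightarrow> real"
  assumes I: "finite I" and simple: "simple_eigenvalue I A a"
    and largest: "\<And>c. eigenvalue (mat_on I A) c \<Longrightarrow> c \<le> a"
    and right: "\<forall>i\<in>I. (\<Sum>j\<in>I. A i j * r j) = a * r i"
    and left: "\<forall>j\<in>I. (\<Sum>i\<in>I. l i * A i j) = a * l j"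
    and lr: "(\<Sum>i\<in>I. l i * r i) = 1"
    and pos: "(\<Sum>i\<in>I. \<Sum>j\<in>I. l i * H i j * r j) > 0"
    and \<delta>: "\<delta> > 0"
  obtains \<tau> \<mu> where "\<tau> > 0" "strict_mono_on {-\<tau><..<\<tau>} \<mu>" "\<mu> 0 = a"
    "\<And>t. \<bar>t\<bar> < \<tau> \<Longrightarrow> \<bar>\<mu> t - a\<bar> < \<delta>"
    "\<And>t. \<bar>t\<bar> < \<tau> \<Longrightarrow> eigenvalue (mat_on I (\<lambda>i j. A i j + t * H i j)) (\<mu> t)"
    "\<And>t c. \<bar>t\<bar> < \<tau> \<Longrightarrow> eigenvalue (mat_on I (\<lambda>i j. A i j + t * H i j)) c \<Longrightarrow> c \<le> \<mu> t"
proof -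
  let ?g = "from_nat_into I" and ?n = "card I"
  define \<alpha> where "\<alpha> = (\<Sum>i\<in>I. \<Sum>j\<in>I. l i * H i j * r j)"
  define S where "S t = mat_on I (\<lambda>i j. A i j + t * H i j)" for t
  have S: "S t \<in> carrier_mat ?n ?n" for t by (simp add: S_def mat_on_def)
  have S0: "S 0 = mat_on I A" by (simp add: S_def)
  \<comment> \<open>Outer variable x, inner variable t: each entry encodes x on the diagonal minus
    \<open>A + t H\<close>.\<close>
  define P where "P = det (mat ?n ?n (\<lambda>(i, j).
    [:[:- A (?g i) (?g j), - H (?g i) (?g j):], if i = j then 1 else 0:]))"
  define f where "f x t = poly (poly P [:x:]) t" for x t
  define fx where "fx x t = poly (poly (pderiv P) [:x:]) t" for x t
  define ft where "ft x t = poly (poly (map_poly pderiv P) [:x:]) t" for x t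
  have f_det: "f x t = det (mat ?n ?n (\<lambda>(i, j). (if i = j then x else 0) - (A (?g i) (?g j) + t * H (?g i) (?g j))))"
    for x t
  proof -
    interpret ev: comm_ring_hom "\<lambda>p. poly (poly p [:x:]) t" by unfold_locales auto
    show ?thesis unfolding f_def P_def ev.hom_det[symmetric]
      by (intro arg_cong[of _ _ det] eq_matI) auto
  qed
  have f_char: "f x t = poly (char_poly (S t)) x" for x t
    unfolding poly_char_poly[OF S] f_det
    by (intro arg_cong[of _ _ det] eq_matI) (auto simp: S_def mat_on_def)
  have eig: "eigenvalue (S t) c \<longleftrightarrow> f c t = 0" for c t
    by (simp add: eigenvalue_root_char_poly[OF S] f_char)
  have chain: "((\<lambda>s. f (x s) (t s)) has_real_derivative fx (x s) (t s) * x' + ft (x s) (t s) * t') (at s)"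
    if "(x has_real_derivative x') (at s)" "(t has_real_derivative t') (at s)" for x t x' t' s
    unfolding f_def fx_def ft_def by (rule has_real_derivative_poly2[OF that])
  have dx: "((\<lambda>x. f x t) has_real_derivative fx x t) (at x)" for x t
    using chain[of "\<lambda>x. x" 1 x "\<lambda>_. t" 0] by simp
  have dt: "((\<lambda>t. f x t) has_real_derivative ft x t) (at t)" for x t
    using chain[of "\<lambda>_. x" 0 t "\<lambda>t. t" 1] by simp
  have order: "order a (char_poly (S 0)) = 1" "eigenvalue (S 0) a"
    using simple by (auto simp: S0 simple_eigenvalue_def)
  have fx_pos: "fx a 0 > 0"
  proof -
    have "((\<lambda>x. f x 0) has_real_derivative poly (pderiv (char_poly (S 0))) a) (at a)"
      unfolding f_char by (rule poly_DERIV)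
    then have "fx a 0 = poly (pderiv (char_poly (S 0))) a" using DERIV_unique dx by blast
    then show ?thesis using pderiv_char_poly_pos[OF S _ order(1)] largest by (simp add: S0)
  qed
  \<comment> \<open>Along the line \<open>s \<mapsto> (a + \<alpha> s, s)\<close> the determinant vanishes to second order.\<close>
  have "fx a 0 * \<alpha> + ft a 0 = 0"
  proof -
    \<comment> \<open>Substituting x = a + \<alpha> s and t = s gives the pencil
      \<open>(a I - A) + s (\<alpha> I - H)\<close>. With \<open>l\<close> and \<open>r\<close>
      normalized, \<alpha> is the number for which \<open>\<alpha> I - H\<close> has vanishing form
      value at l and r.\<close>
    define q where "q = det (mat ?n ?n (\<lambda>(i, j).
      [:(if i = j then a else 0) - A (?g i) (?g j), (if i = j then \<alpha> else 0) - H (?g i) (?g j):]))"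
    have "[:0, 1:] * [:0, 1:] dvd q"
      unfolding q_def
    proof (rule det_pencil_square_dvd[where r = "\<lambda>i. r (?g i)" and l = "\<lambda>i. l (?g i)"])
      have gI: "?g i \<in> I" if "i < ?n" for i
        using bij_betw_from_nat_into_finite[OF I] that by (auto simp: bij_betw_def)
      have d: "(\<Sum>j<?n. (if i = j then c else 0) * x j) = c * x i" "(\<Sum>j<?n. x j * (if j = i then c else 0)) = c * x i"
        if "i < ?n" for i c and x :: "nat \<Rightarrow> real"
      proof -
        have "(\<Sum>j<?n. (if i = j then c else 0) * x j) = (\<Sum>j<?n. if j = i then c * x j else 0)"
          by (intro sum.cong) auto
        also have "\<dots> = c * x i" using that by simp
        finally show 1: "(\<Sum>j<?n. (if i = j then c else 0) * x j) = c * x i" .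
        have "(\<Sum>j<?n. x j * (if j = i then c else 0)) = (\<Sum>j<?n. (if i = j then c else 0) * x j)"
          by (intro sum.cong) auto
        then show "(\<Sum>j<?n. x j * (if j = i then c else 0)) = c * x i" using 1 by simp
      qed
      show "(\<Sum>j<?n. ((if i = j then a else 0) - A (?g i) (?g j)) * r (?g j)) = 0" if "i < ?n" for i
        using right gI[OF that] that
        by (simp add: left_diff_distrib sum_subtractf d sum_from_nat_into[OF I, of "\<lambda>j. A (?g i) j * r j"])
      show "(\<Sum>i<?n. l (?g i) * ((if i = j then a else 0) - A (?g i) (?g j))) = 0" if "j < ?n" for j
        using left gI[OF that] that
        by (simp add: right_diff_distrib sum_subtractf d sum_from_nat_into[OF I, of "\<lambda>i. l i * A i (?g j)"])
      have "(\<Sum>i<?n. l (?g i) * r (?g i)) = 1"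
        using lr sum_from_nat_into[OF I, of "\<lambda>i. l i * r i"] by simp
      moreover from this show "(\<Sum>i<?n. l (?g i) * r (?g i)) \<noteq> 0" by simp
      moreover have "(\<Sum>i<?n. \<Sum>j<?n. l (?g i) * H (?g i) (?g j) * r (?g j)) = \<alpha>"
        unfolding \<alpha>_def
        by (simp add: sum_from_nat_into[OF I, of "\<lambda>j. l (?g _) * H (?g _) j * r j"]
          sum_from_nat_into[OF I, of "\<lambda>i. \<Sum>j\<in>I. l i * H i j * r j"])
      moreover have "(\<Sum>i<?n. \<Sum>j<?n. l (?g i) * (if i = j then \<alpha> else 0) * r (?g j)) = \<alpha> * (\<Sum>i<?n. l (?g i) * r (?g i))"
        by (simp add: mult.assoc sum_distrib_left[symmetric] d) (simp add: sum_distrib_left mult_ac)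
      ultimately show "(\<Sum>i<?n. \<Sum>j<?n. l (?g i) * ((if i = j then \<alpha> else 0) - H (?g i) (?g j)) * r (?g j)) = 0"
        by (simp add: right_diff_distrib left_diff_distrib sum_subtractf)
    qed
    then obtain p where p: "q = [:0, 1:] * [:0, 1:] * p" by (elim dvdE)
    have fq: "f (a + \<alpha> * s) s = poly q s" for s
      unfolding f_det q_def comm_ring_hom.hom_det[OF poly_hom.comm_ring_hom_axioms, symmetric]
      by (intro arg_cong[of _ _ det] eq_matI) (auto simp: algebra_simps)
    \<comment> \<open>The derivative at 0 is computed twice: by the chain rule, and from the double
      zero of \<open>q\<close>.\<close>
    have "((\<lambda>s. f (a + \<alpha> * s) s) has_real_derivative fx a 0 * \<alpha> + ft a 0) (at 0)"
    proof -
      have "((\<lambda>s. a + \<alpha> * s) has_real_derivative \<alpha>) (at 0)" by (auto intro!: derivative_eq_intros)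
      from chain[OF this DERIV_ident] show ?thesis by simp
    qed
    moreover have "((\<lambda>s. f (a + \<alpha> * s) s) has_real_derivative poly (pderiv q) 0) (at 0)"
      unfolding fq by (rule poly_DERIV)
    moreover have "poly (pderiv q) 0 = 0" unfolding p by (simp add: pderiv_mult pderiv_pCons)
    ultimately show ?thesis using DERIV_unique by fastforce
  qed
  moreover have "fx a 0 * \<alpha> > 0" using fx_pos pos by (simp add: \<alpha>_def)
  ultimately have ft_neg: "ft a 0 < 0" by linarith
  \<comment> \<open>This bounds the eigenvalues uniformly for all t of modulus at most 1.\<close>
  define M where "M = (\<Sum>i\<in>I. \<Sum>j\<in>I. \<bar>A i j\<bar> + \<bar>H i j\<bar>)"
  have bound: "f x t \<noteq> 0" if t: "\<bar>t\<bar> \<le> 1" and x: "x > M" for x t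
  proof
    assume "f x t = 0"
    then have "eigenvalue (S t) x" by (simp add: eig)
    then have "\<bar>x\<bar> \<le> (\<Sum>i\<in>I. \<Sum>j\<in>I. \<bar>A i j + t * H i j\<bar>)"
      unfolding S_def by (rule eigenvalue_mat_on_le[OF I])
    also have "\<dots> \<le> M" unfolding M_def
    proof (intro sum_mono)
      fix i j
      have "\<bar>t * H i j\<bar> \<le> \<bar>H i j\<bar>" using t by (simp add: abs_mult mult_left_le_one_le)
      then show "\<bar>A i j + t * H i j\<bar> \<le> \<bar>A i j\<bar> + \<bar>H i j\<bar>" by linarith
    qed
    finally show False using x by simp
  qed
  obtain \<tau> \<mu> where "\<tau> > 0" "strict_mono_on {-\<tau><..<\<tau>} \<mu>" "\<mu> 0 = a"
    "\<And>t. \<bar>t\<bar> < \<tau> \<Longrightarrow> \<bar>\<mu> t - a\<bar> < \<delta>"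
    "\<And>t. \<bar>t\<bar> < \<tau> \<Longrightarrow> f (\<mu> t) t = 0"
    "\<And>t x. \<bar>t\<bar> < \<tau> \<Longrightarrow> x > \<mu> t \<Longrightarrow> f x t \<noteq> 0"
  proof (rule perturbed_largest_root[of f fx ft a M \<delta>])
    show "f a 0 = 0" using order(2) by (simp add: eig)
    show "f x 0 > 0" if "x > a" for x
      unfolding f_char using char_poly_pos_above_eigenvalues[OF S _ that, of 0] largest by (simp add: S0)
  qed (use dx dt fx_pos ft_neg bound \<delta> in \<open>auto simp: f_def fx_def ft_def intro: continuous_on_poly2\<close>)
  then show thesis using that[of \<tau> \<mu>] unfolding S_def[symmetric] eig by (metis not_le)
qed

section \<open>The Ricci matrix of a tree with pendant edges\<close>

text \<open>Loop erasure: if the new first vertex already occurs on the path, everything before that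
  occurrence is dropped.\<close>

lemma rtranclp_distinct_path:
  assumes "r\<^sup>*\<^sup>* a b"
  obtains xs where "xs \<noteq> []" "hd xs = a" "last xs = b" "distinct xs" "successively r xs"
proof -
  have "\<exists>xs. xs \<noteq> [] \<and> hd xs = a \<and> last xs = b \<and> distinct xs \<and> successively r xs"
    using assms
  proof (induction rule: converse_rtranclp_induct)
    case base
    show ?case by (intro exI[of _ "[b]"]) auto
  next
    case (step a c)
    then obtain xs where xs: "xs \<noteq> []" "hd xs = c" "last xs = b" "distinct xs" "successively r xs"
      by blast
    show ?case
    proof (cases "a \<in> set xs")
      case False
      then show ?thesis using xs step.hyps(1)
        by (intro exI[of _ "a # xs"]) (auto simp: successively_Cons)
    next
      case True
      then obtain ys zs where "xs = ys @ a # zs" by (auto dest: split_list)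
      then show ?thesis using xs
        by (intro exI[of _ "a # zs"]) (auto simp: successively_append_iff)
    qed
  qed
  then show thesis using that by blast
qed

section \<open>The branches of a tree at v\<close>

context
  fixes V :: "'a set" and E :: "'a set set" and v :: 'a
  assumes tree: "finite_tree V E" and v: "v \<in> V"
begin

lemma edge_subset: "e \<in> E \<Longrightarrow> e \<subseteq> V" and edge_card: "e \<in> E \<Longrightarrow> card e = 2"
  and finite_V: "finite V"
  using tree by (auto simp: finite_tree_def finite_simple_graph_def)

lemma finite_edge: "e \<in> E \<Longrightarrow> finite e"
  using edge_card card.infinite by fastforce

lemma finite_E: "finite E"
proof -
  have "E \<subseteq> Pow V" using edge_subset by auto
  then show ?thesis using finite_V finite_subset by blast
qed

lemma neighbor_neq: "u \<in> neighbors E v \<Longrightarrow> u \<noteq> v"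
  using edge_card[of "{v, u}"] by (auto simp: neighbors_def)

lemma component_minus_neq:
  assumes "u \<noteq> v" and "w \<in> component_minus E v u"
  shows "w \<noteq> v"
  using assms(2) unfolding component_minus_def mem_Collect_eq
  by (cases rule: rtranclp.cases) (use assms(1) in auto)

lemma component_minus_step:
  "w \<in> component_minus E v u \<Longrightarrow> {w, z} \<in> E \<Longrightarrow> w \<noteq> v \<Longrightarrow> z \<noteq> v \<Longrightarrow> z \<in> component_minus E v u"
  unfolding component_minus_def by (auto intro: rtranclp.rtrancl_into_rtrancl)

text \<open>Follow a walk from v to x: a step out of v enters the component of a neighbour, and a
  step avoiding v stays in its component.\<close>

lemma component_minus_cover:
  assumes "x \<in> V" "x \<noteq> v"
  shows "\<exists>u\<in>neighbors E v. x \<in> component_minus E v u"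
proof -
  have "(\<lambda>a b. {a, b} \<in> E)\<^sup>*\<^sup>* v x"
    using tree v assms(1) by (auto simp: finite_tree_def connected_graph_def)
  then have "x = v \<or> (\<exists>u\<in>neighbors E v. x \<in> component_minus E v u)"
  proof (induction rule: rtranclp_induct)
    case (step y z)
    then show ?case
    proof (cases "z = v \<or> y = v")
      case True
      then show ?thesis using step.hyps(2)
        by (auto simp: neighbors_def component_minus_def intro: exI[of _ z])
    next
      case False
      then show ?thesis using step component_minus_step by blast
    qed
  qed simp
  then show ?thesis using assms(2) by simp
qed

text \<open>Otherwise a path from u to u' avoiding v would close up to a cycle through v.\<close>

lemma component_minus_unique:
  assumes u: "u \<in> neighbors E v" and u': "u' \<in> neighbors E v"
    and w: "w \<in> component_minus E v u" "w \<in> component_minus E v u'"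
  shows "u = u'"
proof (rule ccontr)
  assume "u \<noteq> u'"
  let ?r = "\<lambda>a b. {a, b} \<in> E \<and> a \<noteq> v \<and> b \<noteq> v"
  have "symp ?r" by (rule sympI) (auto simp: insert_commute)
  then have "symp ?r\<^sup>*\<^sup>*" by (rule symp_rtranclp)
  then have "?r\<^sup>*\<^sup>* w u'" using w(2) by (auto simp: component_minus_def dest: sympD)
  then have "?r\<^sup>*\<^sup>* u u'" using w(1) by (auto simp: component_minus_def)
  then obtain xs where xs: "xs \<noteq> []" "hd xs = u" "last xs = u'" "distinct xs" "successively ?r xs"
    by (rule rtranclp_distinct_path)
  have nth: "?r (xs ! i) (xs ! Suc i)" if "Suc i < length xs" for i
    using xs(5) that unfolding successively_conv_nth by blast
  have len: "length xs \<ge> 2"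
    using xs(1-3) \<open>u \<noteq> u'\<close> by (cases xs; cases "tl xs") auto
  \<comment> \<open>The last vertex has no successor on the path; it is u', which differs from v as
    a neighbour of v.\<close>
  have "xs ! i \<noteq> v" if "i < length xs" for i
  proof (cases "Suc i < length xs")
    case False
    then have "i = length xs - 1" using that by simp
    then show ?thesis using xs(1,3) neighbor_neq[OF u'] by (simp add: last_conv_nth)
  qed (use nth in blast)
  then have "v \<notin> set xs" by (auto simp: in_set_conv_nth)
  have "is_cycle E (v # xs)"
    unfolding is_cycle_def
  proof (intro conjI allI impI)
    fix i assume i: "i < length (v # xs)"
    \<comment> \<open>The first and last cases are the closing edges from v to u and from u' back to
      v, the latter by wrap-around of the index.\<close>
    consider "i = 0" | "0 < i" "i < length xs" | "i = length xs" "0 < i" using i by fastforce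
    then show "{(v # xs) ! i, (v # xs) ! (Suc i mod length (v # xs))} \<in> E"
    proof cases
      case 1
      then show ?thesis using xs(1,2) u by (simp add: neighbors_def hd_conv_nth)
    next
      case 2
      then show ?thesis using nth[of "i - 1"] by (simp add: nth_Cons')
    next
      case 3
      then show ?thesis using xs(1,3) u' by (simp add: neighbors_def last_conv_nth nth_Cons' insert_commute)
    qed
  qed (use len xs(4) \<open>v \<notin> set xs\<close> in auto)
  then show False using tree by (auto simp: finite_tree_def)
qed

lemma branch_edges_exists:
  assumes e: "e \<in> E"
  obtains u where "u \<in> neighbors E v" "e \<in> branch_edges E v u"
proof -
  obtain a b where ab: "e = {a, b}" "a \<noteq> b" using edge_card[OF e] by (auto simp: card_2_iff)
  show thesis
  proof (cases "v \<in> e")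
    case True
    then have "e = {v, a} \<or> e = {v, b}" using ab by auto
    then show thesis using that e by (auto simp: branch_edges_def neighbors_def)
  next
    case False
    then obtain u where u: "u \<in> neighbors E v" "a \<in> component_minus E v u"
      using component_minus_cover[of a] edge_subset[OF e] ab by auto
    then have "b \<in> component_minus E v u" using component_minus_step[of a u b] e ab False by auto
    then show thesis using that u e ab by (auto simp: branch_edges_def)
  qed
qed

lemma branch_edges_component:
  "e \<in> branch_edges E v u \<Longrightarrow> z \<in> e \<Longrightarrow> z \<noteq> v \<Longrightarrow> z \<in> component_minus E v u"
  by (auto simp: branch_edges_def component_minus_def)

lemma branch_edges_root:
  "u \<in> neighbors E v \<Longrightarrow> e \<in> branch_edges E v u \<Longrightarrow> v \<in> e \<Longrightarrow> e = {v, u}"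
  using component_minus_neq[of u v] neighbor_neq[of u] by (auto simp: branch_edges_def)

text \<open>A vertex other than v determines its branch, so edges sharing such a vertex lie in one
  branch, while distinct edges meeting only at v lie in different ones. Hence \<open>Q_inf\<close>
  on edges is the Ricci matrix with the contribution of v deleted.\<close>

lemma Q_inf_Some_Some:
  assumes e: "e \<in> E" and e': "e' \<in> E"
  shows "Q_inf E v (Some e) (Some e') =
    (if e = e' then - (\<Sum>x\<in>e - {v}. 1 / real (vdegree E x))
     else (\<Sum>z\<in>e \<inter> e' - {v}. 1 / real (vdegree E z)))"
proof -
  obtain u where u: "u \<in> neighbors E v" "e \<in> branch_edges E v u" by (rule branch_edges_exists[OF e])
  obtain u' where u': "u' \<in> neighbors E v" "e' \<in> branch_edges E v u'" by (rule branch_edges_exists[OF e'])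
  have unique: "w = w'" if "w \<in> neighbors E v" "w' \<in> neighbors E v"
    "a \<in> branch_edges E v w" "b \<in> branch_edges E v w'" "z \<in> a" "z \<in> b" "z \<noteq> v" for w w' a b z
    using component_minus_unique[of w w' z] branch_edges_component that by blast
  \<comment> \<open>Each edge has an endpoint other than v, and this endpoint fixes its
    branch.\<close>
  have "\<exists>z\<in>a. z \<noteq> v" if "a \<in> E" for a
    using edge_card[OF that] by (auto simp: card_2_iff)
  then have unique': "w = w'" if "w \<in> neighbors E v" "w' \<in> neighbors E v"
    "a \<in> branch_edges E v w" "a \<in> branch_edges E v w'" "a \<in> E" for w w' a
    using unique that by blast
  have "{w. w \<in> neighbors E v \<and> e \<in> branch_edges E v w \<and> e' \<in> branch_edges E v w} =
      (if u = u' then {u} else {})"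
    using u u' unique'[OF _ _ _ _ e] unique'[OF _ _ _ _ e'] by auto
  then have Q: "Q_inf E v (Some e) (Some e') = (if u = u' then branch_matrix E v u e e' else 0)"
    by simp
  show ?thesis
  proof (cases "u = u'")
    case False
    then have "e \<noteq> e'" using unique' u u' e by blast
    moreover have "e \<inter> e' - {v} = {}" using unique[OF u(1) u'(1) u(2) u'(2)] False by blast
    then have "(\<Sum>z\<in>e \<inter> e' - {v}. 1 / real (vdegree E z)) = 0" by (simp only: sum.empty)
    ultimately show ?thesis using Q False by simp
  next
    case same: True
    \<comment> \<open>Within a branch only the root edge contains v, so both edges contain v exactly
      at the diagonal entry that \<open>branch_matrix\<close> changes.\<close>
    show ?thesis
    proof (cases "v \<in> e \<inter> e'")
      case True
      then have "e = {v, u}" "e' = {v, u}"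
        using branch_edges_root u u' same by auto
      moreover from this have "e - {v} = {u}" using neighbor_neq[OF u(1)] by auto
      ultimately show ?thesis using Q same by (simp add: branch_matrix_def)
    next
      case False
      then have "e \<noteq> {v, u} \<or> e' \<noteq> {v, u}" "e \<inter> e' - {v} = e \<inter> e'" by auto
      then show ?thesis using Q same False by (auto simp: branch_matrix_def ricci_def)
    qed
  qed
qed

lemma root_edges_iff: "e \<in> E \<Longrightarrow> e \<in> root_edges E v \<longleftrightarrow> v \<in> e"
proof
  assume e: "e \<in> E" "v \<in> e"
  then obtain w where "e = {v, w}" using edge_card[OF e(1)] by (auto simp: card_2_iff)
  then show "e \<in> root_edges E v" using e by (auto simp: root_edges_def neighbors_def)
qed (auto simp: root_edges_def)

section \<open>Degrees and Ricci entries in \<open>T\<^sub>k\<close>\<close>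

lemma vdegree_pendant_other:
  assumes "x \<noteq> v"
  shows "vdegree (pendant_edges E v k) (Inl x) = vdegree E x"
proof -
  have "{e \<in> pendant_edges E v k. Inl x \<in> e} = (`) Inl ` {e \<in> E. x \<in> e}"
    using assms by (auto simp: pendant_edges_def)
  moreover have "inj_on ((`) (Inl :: 'a \<Rightarrow> 'a + nat)) {e \<in> E. x \<in> e}"
    by (intro inj_onI) (metis inj_Inl inj_image_eq_iff)
  ultimately show ?thesis by (simp add: vdegree_def card_image)
qed

lemma inj_pendant: "inj (\<lambda>i. {Inl v, Inr i :: 'a + nat})"
  by (intro injI) (auto simp: doubleton_eq_iff)

lemma vdegree_pendant_center: "vdegree (pendant_edges E v k) (Inl v) = vdegree E v + k"
proof -
  have "{e \<in> pendant_edges E v k. Inl v \<in> e} =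
      (`) Inl ` {e \<in> E. v \<in> e} \<union> (\<lambda>i. {Inl v, Inr i}) ` {..<k}"
    by (auto simp: pendant_edges_def)
  moreover have "inj_on ((`) (Inl :: 'a \<Rightarrow> 'a + nat)) {e \<in> E. v \<in> e}"
    by (intro inj_onI) (metis inj_Inl inj_image_eq_iff)
  moreover have "(`) Inl ` {e \<in> E. v \<in> e} \<inter> (\<lambda>i. {Inl v, Inr i :: 'a + nat}) ` {..<k} = {}"
    by auto
  moreover have "card ((\<lambda>i. {Inl v, Inr i :: 'a + nat}) ` {..<k}) = k"
    using inj_pendant by (simp add: card_image inj_on_subset)
  ultimately show ?thesis
    using finite_E by (simp add: vdegree_def card_image card_Un_disjoint)
qed

lemma vdegree_pendant_leaf: "i < k \<Longrightarrow> vdegree (pendant_edges E v k) (Inr i) = 1"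
proof -
  assume "i < k"
  then have "{e \<in> pendant_edges E v k. Inr i \<in> e} = {{Inl v, Inr i}}"
    by (auto simp: pendant_edges_def)
  then show ?thesis by (simp add: vdegree_def)
qed

lemma sum_pendant_edges:
  "(\<Sum>e\<in>pendant_edges E v k. f e) = (\<Sum>e\<in>E. f (Inl ` e)) + (\<Sum>i<k. f {Inl v, Inr i})"
proof -
  have "inj_on ((`) (Inl :: 'a \<Rightarrow> 'a + nat)) E"
    by (intro inj_onI) (metis inj_Inl inj_image_eq_iff)
  moreover have "inj_on (\<lambda>i. {Inl v, Inr i :: 'a + nat}) {..<k}"
    using inj_pendant by (rule inj_on_subset) simp
  moreover have "(`) Inl ` E \<inter> (\<lambda>i. {Inl v, Inr i :: 'a + nat}) ` {..<k} = {}" by auto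
  ultimately show ?thesis unfolding pendant_edges_def
    using finite_E by (subst sum.union_disjoint) (auto simp: sum.reindex)
qed

text \<open>\<open>B_mat\<close> restores what \<open>Q_inf\<close> leaves out: on root edges v
  contributes its new weight 1 / (d + k), negatively on the diagonal and positively off it.\<close>

lemma ricci_pendant_tree_tree:
  assumes e: "e \<in> E" and e': "e' \<in> E"
  shows "ricci (pendant_edges E v k) (Inl ` e) (Inl ` e') =
    Q_inf E v (Some e) (Some e') + 1 / real (vdegree E v + k) * B_mat E v (Some e) (Some e')"
proof -
  let ?D = "real (vdegree E v + k)"
  have sum: "(\<Sum>x\<in>Inl ` s. 1 / real (vdegree (pendant_edges E v k) x)) =
      (\<Sum>x\<in>s - {v}. 1 / real (vdegree E x)) + (if v \<in> s then 1 / ?D else 0)" if "finite s" for s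
  proof -
    have "(\<Sum>x\<in>Inl ` s. 1 / real (vdegree (pendant_edges E v k) x)) =
        (\<Sum>x\<in>s. 1 / real (vdegree (pendant_edges E v k) (Inl x)))"
      by (subst sum.reindex) auto
    also have "\<dots> = (\<Sum>x\<in>s - {v}. 1 / real (vdegree (pendant_edges E v k) (Inl x))) + (if v \<in> s then 1 / ?D else 0)"
      using that by (auto simp: sum.remove[of s v] vdegree_pendant_center)
    also have "(\<Sum>x\<in>s - {v}. 1 / real (vdegree (pendant_edges E v k) (Inl x))) = (\<Sum>x\<in>s - {v}. 1 / real (vdegree E x))"
      by (intro sum.cong) (auto simp: vdegree_pendant_other)
    finally show ?thesis .
  qed
  have "Inl ` e = (Inl ` e' :: ('a + nat) set) \<longleftrightarrow> e = e'" by (simp add: inj_image_eq_iff)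
  moreover have "Inl ` e \<inter> (Inl ` e' :: ('a + nat) set) = Inl ` (e \<inter> e')" by auto
  ultimately show ?thesis
    using sum[of e] sum[of "e \<inter> e'"] finite_edge[OF e]
    by (auto simp: ricci_def Q_inf_Some_Some[OF e e'] root_edges_iff e e' simp del: Q_inf.simps)
qed

lemma ricci_pendant_tree_leaf:
  assumes i: "i < k"
  shows "ricci (pendant_edges E v k) (Inl ` e) {Inl v, Inr i} = (if v \<in> e then 1 / real (vdegree E v + k) else 0)"
    and "ricci (pendant_edges E v k) {Inl v, Inr i} (Inl ` e) = (if v \<in> e then 1 / real (vdegree E v + k) else 0)"
proof -
  have int: "Inl ` e \<inter> {Inl v, Inr i} = (if v \<in> e then {Inl v} else {})" by auto
  have neq: "Inl ` e \<noteq> {Inl v, Inr i}" by auto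
  show 1: "ricci (pendant_edges E v k) (Inl ` e) {Inl v, Inr i} = (if v \<in> e then 1 / real (vdegree E v + k) else 0)"
    using neq by (simp add: ricci_def int vdegree_pendant_center)
  show "ricci (pendant_edges E v k) {Inl v, Inr i} (Inl ` e) = (if v \<in> e then 1 / real (vdegree E v + k) else 0)"
    unfolding 1[symmetric] ricci_def using neq by (auto simp: Int_commute)
qed

text \<open>The pendant block is a constant matrix minus a multiple of the identity. This form
  isolates the exceptional eigenvalue, whose eigenvectors live on pendant edges with coordinate sum
  zero.\<close>

lemma ricci_pendant_leaf_leaf:
  assumes "i < k" "j < k"
  shows "ricci (pendant_edges E v k) {Inl v, Inr i} {Inl v, Inr j} =
    1 / real (vdegree E v + k) - (if j = i then 1 + 2 / real (vdegree E v + k) else 0)"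
proof (cases "i = j")
  case True
  then show ?thesis using assms
    by (simp add: ricci_def vdegree_pendant_center vdegree_pendant_leaf)
next
  case False
  then have "{Inl v, Inr i} \<inter> {Inl v, Inr j} = {Inl v :: 'a + nat}"
    "{Inl v, Inr i} \<noteq> {Inl v :: 'a + nat, Inr j}" by (auto simp: doubleton_eq_iff)
  then show ?thesis using False by (simp add: ricci_def vdegree_pendant_center)
qed

text \<open>
  Off the eigenvalue \<open>- 1 - 2 / D\<close>, where \<open>D\<close> is the degree of \<open>v\<close> in \<open>T\<^sub>k\<close>, an eigenvector is constant
  on the pendant edges; the common value is the coordinate \<^const>\<open>None\<close> of the quotient matrix.
\<close>
lemma eigenvalue_ricci_pendant:
  assumes k: "k > 0" and c: "c \<noteq> - 1 - 2 / real (vdegree E v + k)"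
  shows "eigenvalue (mat_on (pendant_edges E v k) (ricci (pendant_edges E v k))) c \<longleftrightarrow>
    eigenvalue (mat_on (ext_index E) (\<lambda>i j. Q_inf E v i j + 1 / real (vdegree E v + k) * B_mat E v i j)) c"
    (is "?L \<longleftrightarrow> ?R")
proof -
  let ?K = "pendant_edges E v k" and ?D = "real (vdegree E v + k)"
  let ?p = "\<lambda>i. {Inl v, Inr i :: 'a + nat}"
  let ?M = "\<lambda>i j. Q_inf E v i j + 1 / ?D * B_mat E v i j"
  have D: "?D > 0" using k by simp
  have finK: "finite ?K" using finite_E by (simp add: pendant_edges_def)
  have finX: "finite (ext_index E)" using finite_E by (simp add: ext_index_def)
  have sumX: "(\<Sum>j\<in>ext_index E. f j) = f None + (\<Sum>e\<in>E. f (Some e))" for f :: "'a set option \<Rightarrow> real"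
    unfolding ext_index_def using finite_E by (subst sum.insert) (auto simp: sum.reindex)
  have memK: "Inl ` e \<in> ?K" if "e \<in> E" for e using that by (auto simp: pendant_edges_def)
  have memKp: "?p i \<in> ?K" if "i < k" for i using that by (auto simp: pendant_edges_def)
  have memX: "Some e \<in> ext_index E \<longleftrightarrow> e \<in> E" "None \<in> ext_index E" for e by (auto simp: ext_index_def)
  define \<rho> where "\<rho> e = (if v \<in> e then 1 else 0 :: real)" for e
  define W where "W z = (\<Sum>e\<in>E. \<rho> e * z e)" for z
  have rowK_tree: "(\<Sum>f\<in>?K. ricci ?K (Inl ` e) f * x f) =
      (\<Sum>e'\<in>E. ?M (Some e) (Some e') * x (Inl ` e')) + \<rho> e / ?D * (\<Sum>i<k. x (?p i))"
    if "e \<in> E" for e x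
    unfolding sum_pendant_edges
    using that by (simp add: ricci_pendant_tree_tree ricci_pendant_tree_leaf \<rho>_def sum_distrib_left
        del: Q_inf.simps B_mat.simps)
  have rowK_leaf: "(\<Sum>f\<in>?K. ricci ?K (?p i) f * x f) =
      1 / ?D * (W (\<lambda>e. x (Inl ` e)) + (\<Sum>j<k. x (?p j))) - (1 + 2 / ?D) * x (?p i)"
    if i: "i < k" for i x
  proof -
    have "(\<Sum>j<k. ricci ?K (?p i) (?p j) * x (?p j)) =
        (\<Sum>j<k. 1 / ?D * x (?p j) - (if j = i then (1 + 2 / ?D) * x (?p j) else 0))"
      using i by (intro sum.cong) (auto simp: ricci_pendant_leaf_leaf left_diff_distrib)
    also have "\<dots> = 1 / ?D * (\<Sum>j<k. x (?p j)) - (1 + 2 / ?D) * x (?p i)"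
      using i by (simp add: sum_subtractf sum_distrib_left)
    finally have 1: "(\<Sum>j<k. ricci ?K (?p i) (?p j) * x (?p j)) =
      1 / ?D * (\<Sum>j<k. x (?p j)) - (1 + 2 / ?D) * x (?p i)" .
    have 2: "(\<Sum>e\<in>E. ricci ?K (?p i) (Inl ` e) * x (Inl ` e)) = 1 / ?D * W (\<lambda>e. x (Inl ` e))"
      unfolding W_def sum_distrib_left
      by (intro sum.cong) (auto simp: ricci_pendant_tree_leaf(2)[OF i] \<rho>_def)
    show ?thesis unfolding sum_pendant_edges 1 2 by (simp only: algebra_simps)
  qed
  have rowX_tree: "(\<Sum>j\<in>ext_index E. ?M (Some e) j * y j) =
      (\<Sum>e'\<in>E. ?M (Some e) (Some e') * y (Some e')) + \<rho> e / ?D * (real k * y None)"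
    if "e \<in> E" for e y
  proof -
    \<comment> \<open>For a root edge the entry is 1 - d / D = k / D, the total weight of k equal
      pendant coordinates.\<close>
    have "?M (Some e) None = \<rho> e / ?D * real k"
      using D that by (simp add: \<rho>_def root_edges_iff field_simps)
    then show ?thesis unfolding sumX by (simp del: Q_inf.simps B_mat.simps)
  qed
  have rowX_leaf: "(\<Sum>j\<in>ext_index E. ?M None j * y j) =
      1 / ?D * (W (\<lambda>e. y (Some e)) + real k * y None) - (1 + 2 / ?D) * y None" for y
  proof -
    have m1: "(\<Sum>e\<in>E. ?M None (Some e) * y (Some e)) = 1 / ?D * W (\<lambda>e. y (Some e))"
      unfolding W_def sum_distrib_left by (intro sum.cong) (auto simp: \<rho>_def root_edges_iff)
    \<comment> \<open>As d = D - k, the entry - (d + 2) / D splits into the constant part k / D and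
      the diagonal part - (1 + 2 / D).\<close>
    have m2: "?M None None = 1 / ?D * real k - (1 + 2 / ?D)"
    proof -
      have "0 + 1 / a * - (b + 2) = 1 / a * c - (1 + 2 / a)" if "a > 0" "a = b + c" for a b c :: real
      proof -
        have "b = a - c" using that(2) by simp
        then show ?thesis using that(1) by (simp add: field_simps)
      qed
      from this[OF D] show ?thesis by simp
    qed
    show ?thesis unfolding sumX m1 m2 by (simp only: algebra_simps)
  qed
  show ?thesis unfolding eigenvalue_mat_on[OF finK] eigenvalue_mat_on[OF finX]
  proof
    assume "\<exists>x. (\<exists>i\<in>?K. x i \<noteq> 0) \<and> (\<forall>i\<in>?K. (\<Sum>j\<in>?K. ricci ?K i j * x j) = c * x i)"
    then obtain x where nz: "\<exists>i\<in>?K. x i \<noteq> 0" and eq: "\<And>i. i \<in> ?K \<Longrightarrow> (\<Sum>j\<in>?K. ricci ?K i j * x j) = c * x i"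
      by blast
    define s where "s = x (?p 0)"
    let ?S = "1 / ?D * (W (\<lambda>e. x (Inl ` e)) + (\<Sum>j<k. x (?p j)))"
    \<comment> \<open>The right-hand side is the same for all pendant edges, so the nonzero factor
      on the left forces equal coordinates.\<close>
    have leaf: "(c + 1 + 2 / ?D) * x (?p i) = ?S" if "i < k" for i
      using eq[OF memKp[OF that]] unfolding rowK_leaf[OF that] by (simp only: algebra_simps)
    have const: "x (?p i) = s" if "i < k" for i
    proof -
      have "(c + 1 + 2 / ?D) * x (?p i) = (c + 1 + 2 / ?D) * s" using leaf[OF that] leaf[OF k] by (simp only: s_def)
      then show ?thesis using c by (simp del: of_nat_add)
    qed
    then have sum: "(\<Sum>j<k. x (?p j)) = real k * s" by simp
    define y where "y i = (case i of None \<Rightarrow> s | Some e \<Rightarrow> x (Inl ` e))" for i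
    have "(\<Sum>j\<in>ext_index E. ?M i j * y j) = c * y i" if "i \<in> ext_index E" for i
    proof (cases i)
      case None
      show ?thesis using eq[OF memKp[OF k]] unfolding None rowX_leaf rowK_leaf[OF k] sum by (simp only: y_def option.case s_def)
    next
      case (Some e)
      then have e: "e \<in> E" using that memX by simp
      show ?thesis using eq[OF memK[OF e]] unfolding Some rowX_tree[OF e] rowK_tree[OF e] sum by (simp only: y_def option.case)
    qed
    moreover have "\<exists>i\<in>ext_index E. y i \<noteq> 0"
    proof -
      obtain i where i: "i \<in> ?K" "x i \<noteq> 0" using nz by blast
      then consider e where "e \<in> E" "i = Inl ` e" | j where "j < k" "i = ?p j" by (auto simp: pendant_edges_def)
      then show ?thesis
        by cases (use i const memX in \<open>auto simp: y_def intro: bexI[of _ "Some _"] bexI[of _ None]\<close>)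
    qed
    ultimately show "\<exists>y. (\<exists>i\<in>ext_index E. y i \<noteq> 0) \<and> (\<forall>i\<in>ext_index E. (\<Sum>j\<in>ext_index E. ?M i j * y j) = c * y i)"
      by blast
  next
    assume "\<exists>y. (\<exists>i\<in>ext_index E. y i \<noteq> 0) \<and> (\<forall>i\<in>ext_index E. (\<Sum>j\<in>ext_index E. ?M i j * y j) = c * y i)"
    then obtain y where nz: "\<exists>i\<in>ext_index E. y i \<noteq> 0"
      and eq: "\<And>i. i \<in> ext_index E \<Longrightarrow> (\<Sum>j\<in>ext_index E. ?M i j * y j) = c * y i"
      by blast
    \<comment> \<open>The preimage under \<open>Inl\<close> recovers a tree edge from its tagged
      copy; every pendant edge receives the coordinate y.\<close>
    define x where "x f = (if f \<in> (`) Inl ` E then y (Some (Inl -` f)) else y None)" for f :: "('a + nat) set"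
    have "Inl -` (Inl ` e :: ('a + nat) set) = e" for e by auto
    then have xe: "x (Inl ` e) = y (Some e)" if "e \<in> E" for e using that by (simp add: x_def)
    have "?p i \<notin> (`) Inl ` E" for i by auto
    then have xp: "x (?p i) = y None" for i by (simp add: x_def)
    have sum: "(\<Sum>j<k. x (?p j)) = real k * y None" by (simp add: xp)
    have W: "W (\<lambda>e. x (Inl ` e)) = W (\<lambda>e. y (Some e))" by (simp add: W_def xe)
    have "(\<Sum>j\<in>?K. ricci ?K f j * x j) = c * x f" if "f \<in> ?K" for f
    proof -
      consider e where "e \<in> E" "f = Inl ` e" | j where "j < k" "f = ?p j" using \<open>f \<in> ?K\<close> by (auto simp: pendant_edges_def)
      then show ?thesis
      proof cases
        case 1
        have "(\<Sum>e'\<in>E. ?M (Some e) (Some e') * x (Inl ` e')) = (\<Sum>e'\<in>E. ?M (Some e) (Some e') * y (Some e'))"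
          by (intro sum.cong) (auto simp: xe)
        then show ?thesis using eq[of "Some e"] 1 memX
          unfolding 1(2) rowX_tree[OF 1(1)] rowK_tree[OF 1(1)] sum xe[OF 1(1)] by simp
      next
        case 2
        show ?thesis using eq[OF memX(2)]
          unfolding 2(2) rowX_leaf rowK_leaf[OF 2(1)] unfolding sum unfolding xp W .
      qed
    qed
    moreover have "\<exists>f\<in>?K. x f \<noteq> 0"
    proof -
      obtain i where i: "i \<in> ext_index E" "y i \<noteq> 0" using nz by blast
      show ?thesis
      proof (cases i)
        case None
        then have "x (?p 0) \<noteq> 0" using i xp[of 0] by simp
        then show ?thesis using memKp[OF k] by blast
      next
        case (Some e)
        then have "e \<in> E" "x (Inl ` e) \<noteq> 0" using i xe memX by auto
        then show ?thesis using memK by blast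
      qed
    qed
    ultimately show "\<exists>x. (\<exists>i\<in>?K. x i \<noteq> 0) \<and> (\<forall>i\<in>?K. (\<Sum>j\<in>?K. ricci ?K i j * x j) = c * x i)"
      by blast
  qed
qed

end

section \<open>The largest eigenvalue of \<open>T\<^sub>k\<close> for large k\<close>

text \<open>The sign s lets one increasing branch \<mu> serve both cases: it belongs to the
  perturbation \<open>s B\<close> and is evaluated at \<open>s / (d + k)\<close>.\<close>

lemma lambda_max_pendant_eventually:
  fixes V :: "'a set"
  assumes tree: "finite_tree V E" and v: "v \<in> V"
    and lam_inf: "lam_inf = lambda_max (ext_index E) (Q_inf E v)"
    and simple: "simple_eigenvalue (ext_index E) (Q_inf E v) lam_inf"
    and right: "\<forall>i\<in>ext_index E. (\<Sum>j\<in>ext_index E. Q_inf E v i j * r j) = lam_inf * r i"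
    and left: "\<forall>j\<in>ext_index E. (\<Sum>i\<in>ext_index E. l i * Q_inf E v i j) = lam_inf * l j"
    and normalized: "(\<Sum>i\<in>ext_index E. l i * r i) = 1"
    and sign: "s = 1 \<or> s = -1"
    and pos: "s * (\<Sum>i\<in>ext_index E. \<Sum>j\<in>ext_index E. l i * B_mat E v i j * r j) > 0"
  obtains K \<tau> \<mu> where "K > 0" "strict_mono_on {-\<tau><..<\<tau>} \<mu>" "\<mu> 0 = lam_inf"
    "\<And>k. k \<ge> K \<Longrightarrow> 1 / real (vdegree E v + k) < \<tau>"
    "\<And>k. k \<ge> K \<Longrightarrow> lambda_max (pendant_edges E v k) (ricci (pendant_edges E v k)) =
       \<mu> (s * (1 / real (vdegree E v + k)))"
proof -
  let ?X = "ext_index E"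
  have fin: "finite ?X" using finite_E[OF tree v] by (simp add: ext_index_def)
  have largest: "c \<le> lam_inf" if "eigenvalue (mat_on ?X (Q_inf E v)) c" for c
    using that finite_eigenvalues_mat_on unfolding lam_inf lambda_max_def by (intro Max_ge) auto
  have "eigenvalue (mat_on ?X (Q_inf E v)) 0"
    by (rule eigenvalue_mat_on_zero_row[OF fin, of None]) (auto simp: ext_index_def)
  then have "lam_inf \<ge> 0" by (rule largest)
  have pos': "(\<Sum>i\<in>?X. \<Sum>j\<in>?X. l i * (s * B_mat E v i j) * r j) > 0"
    using pos by (simp add: sum_distrib_left mult_ac)
  obtain \<tau> \<mu> where \<mu>: "\<tau> > 0" "strict_mono_on {-\<tau><..<\<tau>} \<mu>" "\<mu> 0 = lam_inf"
    "\<And>t. \<bar>t\<bar> < \<tau> \<Longrightarrow> \<bar>\<mu> t - lam_inf\<bar> < 1"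
    "\<And>t. \<bar>t\<bar> < \<tau> \<Longrightarrow> eigenvalue (mat_on ?X (\<lambda>i j. Q_inf E v i j + t * (s * B_mat E v i j))) (\<mu> t)"
    "\<And>t c. \<bar>t\<bar> < \<tau> \<Longrightarrow> eigenvalue (mat_on ?X (\<lambda>i j. Q_inf E v i j + t * (s * B_mat E v i j))) c \<Longrightarrow> c \<le> \<mu> t"
    by (rule largest_eigenvalue_perturbation[where \<delta> = 1, OF fin simple _ right left normalized pos'])
      (blast intro: largest, simp, blast)
  obtain K where K: "K > 0" "inverse (real K) < \<tau>"
    using ex_inverse_of_nat_less[OF \<mu>(1)] by blast
  have small: "1 / real (vdegree E v + k) < \<tau>" if "k \<ge> K" for k
  proof -
    have "1 / real (vdegree E v + k) \<le> 1 / real K" using K(1) that by (intro divide_left_mono) auto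
    then show ?thesis using K(2) by (simp add: inverse_eq_divide)
  qed
  have "lambda_max (pendant_edges E v k) (ricci (pendant_edges E v k)) = \<mu> (s * (1 / real (vdegree E v + k)))"
    if k: "k \<ge> K" for k
  proof -
    let ?t = "1 / real (vdegree E v + k)"
    have "k > 0" using k K(1) by simp
    have "?t > 0" using \<open>k > 0\<close> by simp
    have t: "\<bar>s * ?t\<bar> < \<tau>" using small[OF k] \<open>?t > 0\<close> sign by (auto simp: abs_mult)
    \<comment> \<open>The two signs cancel, which turns the perturbation by \<open>s B\<close> at
      parameter \<open>s t\<close> into the one by \<open>B\<close> at t.\<close>
    have s2: "s * ?t * (s * x) = ?t * x" for x using sign by auto
    \<comment> \<open>The perturbation lemma was used with distance 1, so \<mu> stays above
      \<open>lam_inf - 1\<close>, hence above -1 and above the exceptional eigenvalue.\<close>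
    have gt: "\<mu> (s * ?t) > - 1 - 2 / real (vdegree E v + k)"
      using \<mu>(4)[OF t] \<open>lam_inf \<ge> 0\<close> \<open>?t > 0\<close> by (smt (verit) divide_nonneg_nonneg of_nat_0_le_iff)
    note iff = eigenvalue_ricci_pendant[OF tree v \<open>k > 0\<close>]
    show ?thesis unfolding lambda_max_def
    proof (rule Max_eqI)
      show "finite {c. eigenvalue (mat_on (pendant_edges E v k) (ricci (pendant_edges E v k))) c}"
        by (rule finite_eigenvalues_mat_on)
      show "\<mu> (s * ?t) \<in> {c. eigenvalue (mat_on (pendant_edges E v k) (ricci (pendant_edges E v k))) c}"
        using \<mu>(5)[OF t] iff[of "\<mu> (s * ?t)"] gt unfolding s2 by simp
    next
      fix c assume "c \<in> {c. eigenvalue (mat_on (pendant_edges E v k) (ricci (pendant_edges E v k))) c}"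
      \<comment> \<open>The exceptional eigenvalue lies below \<mu> directly; any other one is an
        eigenvalue of the quotient matrix.\<close>
      then show "c \<le> \<mu> (s * ?t)"
        using \<mu>(6)[OF t, of c] iff[of c] gt unfolding s2
        by (cases "c = - 1 - 2 / real (vdegree E v + k)") auto
    qed
  qed
  then show thesis using that[of K \<tau> \<mu>] K(1) \<mu>(2,3) small by blast
qed

theorem theorem1:
  fixes V :: "'a set" and E :: "'a set set" and v :: 'a
    and lam :: "nat \<Rightarrow> real" and lam_inf alpha :: real
    and r l :: "'a set option \<Rightarrow> real"
  assumes tree: "finite_tree V E"
    and edge: "E \<noteq> {}"
    and v: "v \<in> V"
    and lam: "lam = (\<lambda>k. lambda_max (pendant_edges E v k) (ricci (pendant_edges E v k)))"
    and lam_inf: "lam_inf = lambda_max (ext_index E) (Q_inf E v)"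
    and simple: "simple_eigenvalue (ext_index E) (Q_inf E v) lam_inf"
    and right: "\<forall>i\<in>ext_index E. (\<Sum>j\<in>ext_index E. Q_inf E v i j * r j) = lam_inf * r i"
    and left: "\<forall>j\<in>ext_index E. (\<Sum>i\<in>ext_index E. l i * Q_inf E v i j) = lam_inf * l j"
    and normalized: "(\<Sum>i\<in>ext_index E. l i * r i) = 1"
    and alpha: "alpha = (\<Sum>i\<in>ext_index E. \<Sum>j\<in>ext_index E. l i * B_mat E v i j * r j)"
    and nonzero: "alpha \<noteq> 0"
  shows "(\<exists>K. strict_mono_on {K..} lam \<or> strict_antimono_on {K..} lam) \<and>
    (alpha > 0 \<longrightarrow> (\<exists>K. \<forall>k\<ge>K. lam k > lam_inf \<and> lam (Suc k) < lam k)) \<and>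
    (alpha < 0 \<longrightarrow> (\<exists>K. \<forall>k\<ge>K. lam k < lam_inf \<and> lam (Suc k) > lam k))"
proof -
  let ?t = "\<lambda>k. 1 / real (vdegree E v + k)"
  \<comment> \<open>Positivity of k makes the denominators positive, so the tails below start at a
    positive \<open>K\<close>.\<close>
  have t_less: "?t j < ?t k" if "0 < k" "k < j" for j k
    using that by (intro divide_strict_left_mono) auto
  \<comment> \<open>Comparing with all later indices yields both strict monotonicity on a tail and
    the inequality for consecutive indices.\<close>
  have decreasing: "\<exists>K. \<forall>k\<ge>K. lam k > lam_inf \<and> (\<forall>j>k. lam j < lam k)" if "alpha > 0"
  proof -
    obtain K \<tau> \<mu> where K: "K > 0" "strict_mono_on {-\<tau><..<\<tau>} \<mu>" "\<mu> 0 = lam_inf"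
      "\<And>k. k \<ge> K \<Longrightarrow> ?t k < \<tau>"
      "\<And>k. k \<ge> K \<Longrightarrow> lambda_max (pendant_edges E v k) (ricci (pendant_edges E v k)) = \<mu> (1 * ?t k)"
      by (rule lambda_max_pendant_eventually[OF tree v lam_inf simple right left normalized, of "1"])
        (use \<open>alpha > 0\<close> in \<open>simp_all add: alpha\<close>)
    have lamk: "lam k = \<mu> (1 * ?t k)" if "k \<ge> K" for k using K(5)[OF that] by (simp add: lam)
    have "lam k > lam_inf \<and> (\<forall>j>k. lam j < lam k)" if k: "k \<ge> K" for k
    proof -
      have mem: "?t j > 0" "?t j \<in> {-\<tau><..<\<tau>}" "- ?t j \<in> {-\<tau><..<\<tau>}" "0 \<in> {-\<tau><..<\<tau>}"
        if "j \<ge> K" for j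
      proof -
        show "?t j > 0" using K(1) that by simp
        then show "?t j \<in> {-\<tau><..<\<tau>}" "- ?t j \<in> {-\<tau><..<\<tau>}" "0 \<in> {-\<tau><..<\<tau>}"
          using K(4)[OF that] unfolding greaterThanLessThan_iff by linarith+
      qed
      have "lam k > lam_inf"
        using strict_mono_onD[OF K(2) mem(4,2)[OF k] mem(1)[OF k]] K(3) lamk[OF k] by simp
      moreover have "lam j < lam k" if "j > k" for j
      proof -
        have j: "j \<ge> K" using that k by simp
        show ?thesis
          using strict_mono_onD[OF K(2) mem(2)[OF j] mem(2)[OF k] t_less] K(1) k that
            lamk[OF k] lamk[OF j] by simp
      qed
      ultimately show ?thesis by blast
    qed
    then show ?thesis by blast
  qed
  \<comment> \<open>Here \<mu> is evaluated at - 1 / (d + k), which increases to 0 from below as k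
    grows.\<close>
  have increasing: "\<exists>K. \<forall>k\<ge>K. lam k < lam_inf \<and> (\<forall>j>k. lam j > lam k)" if "alpha < 0"
  proof -
    obtain K \<tau> \<mu> where K: "K > 0" "strict_mono_on {-\<tau><..<\<tau>} \<mu>" "\<mu> 0 = lam_inf"
      "\<And>k. k \<ge> K \<Longrightarrow> ?t k < \<tau>"
      "\<And>k. k \<ge> K \<Longrightarrow> lambda_max (pendant_edges E v k) (ricci (pendant_edges E v k)) = \<mu> (- 1 * ?t k)"
      by (rule lambda_max_pendant_eventually[OF tree v lam_inf simple right left normalized, of "-1"])
        (use \<open>alpha < 0\<close> in \<open>simp_all add: alpha\<close>)
    have lamk: "lam k = \<mu> (- 1 * ?t k)" if "k \<ge> K" for k using K(5)[OF that] by (simp add: lam)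
    have "lam k < lam_inf \<and> (\<forall>j>k. lam j > lam k)" if k: "k \<ge> K" for k
    proof -
      have mem: "?t j > 0" "?t j \<in> {-\<tau><..<\<tau>}" "- ?t j \<in> {-\<tau><..<\<tau>}" "0 \<in> {-\<tau><..<\<tau>}"
        if "j \<ge> K" for j
      proof -
        show "?t j > 0" using K(1) that by simp
        then show "?t j \<in> {-\<tau><..<\<tau>}" "- ?t j \<in> {-\<tau><..<\<tau>}" "0 \<in> {-\<tau><..<\<tau>}"
          using K(4)[OF that] unfolding greaterThanLessThan_iff by linarith+
      qed
      have "lam k < lam_inf"
        using strict_mono_onD[OF K(2) mem(3,4)[OF k]] mem(1)[OF k] K(3) lamk[OF k] by simp
      moreover have "lam j > lam k" if "j > k" for j
      proof -
        have j: "j \<ge> K" using that k by simp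
        show ?thesis
          using strict_mono_onD[OF K(2) mem(3)[OF k] mem(3)[OF j]] t_less[of k j] K(1) k that
            lamk[OF k] lamk[OF j] by simp
      qed
      ultimately show ?thesis by blast
    qed
    then show ?thesis by blast
  qed
  have "\<exists>K. strict_mono_on {K..} lam \<or> strict_antimono_on {K..} lam"
  proof (cases "alpha > 0")
    case True
    then obtain K where "\<forall>k\<ge>K. \<forall>j>k. lam j < lam k" using decreasing by blast
    then have "strict_antimono_on {K..} lam" by (auto simp: monotone_on_def)
    then show ?thesis by blast
  next
    case False
    then obtain K where "\<forall>k\<ge>K. \<forall>j>k. lam j > lam k" using increasing nonzero by force
    then have "strict_mono_on {K..} lam" by (auto simp: monotone_on_def)
    then show ?thesis by blast
  qed
  then show ?thesis using decreasing increasing by (meson lessI)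
qed

end
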